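(* Let $\xi=(\xi_s)_{s\ge 0}$ be a one-dimensional Lévy process with $\lim_{s\to\infty}\xi_s=\infty$ almost surely. Let $f:\mathbb{R}\to[0,\infty)$ be a Borel measurable function which is either continuous, or locally bounded and ultimately non-increasing (i.e. there is $l\in\mathbb{R}$ such that $f$ is non-increasing on $[l,\infty)$). Let $x\in\mathbb{R}$. Then $$\mathbb{P}\left(\int_0^\infty f(x+\xi_s)\,ds<\infty\right)=0$$ if and only if $$\int_E f(x+y)\,U(dy)=\infty\quad\text{for every Borel set }E\subseteq\mathbb{R}\text{ such that }\mathbb{R}\setminus E\text{ is }\mathbb{P}^x\text{-transient}.$$ Otherwise, i.e. if $\int_E f(x+y)\,U(dy)<\infty$ for some Borel set $E$ with $\mathbb{R}\setminus E$ being $\mathbb{P}^x$-transient, one has $\int_0^\infty f(x+\xi_s)\,ds<\infty$ almost surely.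
   Context: A Lévy process is an almost surely right-continuous (with left limits) real-valued process with stationary independent increments, started at $\xi_0=0$ under $\mathbb{P}$. For $x\in\mathbb{R}$, $\mathbb{P}^x$ denotes the law of $x+\xi$. The potential measure of $\xi$ is $U(dy)=\int_0^\infty \mathbb{P}(\xi_s\in dy)\,ds$, which is finite on compact sets since $\xi$ is transient. For a Borel set $E\subseteq\mathbb{R}$, the set $\mathbb{R}\setminus E$ is called $\mathbb{P}^x$-transient if $\mathbb{P}^x(\exists\,\tau\ge 0:\ \xi_s\in E\ \ \forall s\ge\tau)=1$, i.e. $\mathbb{P}(\exists\,\tau\ge 0:\ x+\xi_s\in E\ \ \forall s\ge\tau)=1$.
   Formalization: The integral of f(x+y) U(dy) is taken over those y with x+y in E rather than y in E; with y in E the claim fails, e.g. for a Poisson process, f = 1, x = 1/2, E = 1/2 + Z. *)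

theory Defs
  imports "HOL-Probability.Probability"
begin

text \<open>
  The index type is \<open>real\<close>, but only the values \<open>\<xi> s\<close> with \<open>0 \<le> s\<close> are constrained and used.
  The starting point and the path regularity are only required almost surely. As \<open>M\<close> need not be
  complete, statements of the form ``the event has probability 0 (or 1)'' are written with
  \<open>AE\<close>, which does not require the event itself to be in \<open>sets M\<close>.
\<close>

locale levy_process = prob_space M
  for M :: "'a measure" and \<xi> :: "real \<Rightarrow> 'a \<Rightarrow> real" +
  assumes random_variable_levy: "\<And>s. 0 \<le> s \<Longrightarrow> \<xi> s \<in> borel_measurable M"
    and start_zero: "AE \<omega> in M. \<xi> 0 \<omega> = 0"
    and independent_increments:
      "\<And>(n::nat) (t::nat \<Rightarrow> real). 0 \<le> t 0 \<Longrightarrow> (\<And>i. i < n \<Longrightarrow> t i < t (Suc i)) \<Longrightarrow>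
         indep_vars (\<lambda>_. borel) (\<lambda>i \<omega>. \<xi> (t (Suc i)) \<omega> - \<xi> (t i) \<omega>) {..<n}"
    and stationary_increments:
      "\<And>s t. 0 \<le> s \<Longrightarrow> 0 \<le> t \<Longrightarrow>
         distr M borel (\<lambda>\<omega>. \<xi> (s + t) \<omega> - \<xi> s \<omega>) = distr M borel (\<xi> t)"
    and cadlag_paths:
      "AE \<omega> in M. (\<forall>s\<ge>0. continuous (at_right s) (\<lambda>r. \<xi> r \<omega>)) \<and>
                  (\<forall>s>0. \<exists>l. ((\<lambda>r. \<xi> r \<omega>) \<longlongrightarrow> l) (at_left s))"

definition potential_measure :: "'a measure \<Rightarrow> (real \<Rightarrow> 'a \<Rightarrow> real) \<Rightarrow> real measure" where
  "potential_measure M \<xi> = measure_of UNIV (sets borel)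
     (\<lambda>A. \<integral>\<^sup>+ s\<in>{0..}. emeasure M {\<omega> \<in> space M. \<xi> s \<omega> \<in> A} \<partial>lborel)"

definition transient_set ::
  "'a measure \<Rightarrow> (real \<Rightarrow> 'a \<Rightarrow> real) \<Rightarrow> real \<Rightarrow> real set \<Rightarrow> bool" where
  "transient_set M \<xi> x B \<longleftrightarrow>
     (AE \<omega> in M. \<exists>\<tau>\<ge>0. \<forall>s\<ge>\<tau>. x + \<xi> s \<omega> \<in> - B)"

definition locally_bounded :: "(real \<Rightarrow> real) \<Rightarrow> bool" where
  "locally_bounded f \<longleftrightarrow> (\<forall>y. \<exists>V. open V \<and> y \<in> V \<and> bounded (f ` V))"

definition ultimately_nonincreasing :: "(real \<Rightarrow> real) \<Rightarrow> bool" where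
  "ultimately_nonincreasing f \<longleftrightarrow> (\<exists>l. antimono_on {l..} f)"

definition perpetual_integral ::
  "(real \<Rightarrow> 'a \<Rightarrow> real) \<Rightarrow> (real \<Rightarrow> real) \<Rightarrow> real \<Rightarrow> 'a \<Rightarrow> ennreal" where
  "perpetual_integral \<xi> f x \<omega> = (\<integral>\<^sup>+ s\<in>{0..}. ennreal (f (x + \<xi> s \<omega>)) \<partial>lborel)"

text \<open>
  The integral of \<open>f(x + y)\<close> against \<open>U(dy)\<close> over a set \<open>E\<close> of \<^emph>\<open>positions of the process started
  at \<open>x\<close>\<close>: the variable \<open>y\<close> of \<open>U\<close> is the displacement from \<open>x\<close>, so \<open>y\<close> ranges over
  \<open>x + y \<in> E\<close>, in accordance with the role of \<open>E\<close> in transience under \<open>P\<^sup>x\<close>. Writing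
  \<open>y \<in> E\<close> instead would mix the two coordinates: for a Poisson process, \<open>x = 1/2\<close> and
  \<open>E = 1/2 + \<int>\<close>, the process started at \<open>x\<close> never leaves \<open>E\<close>, whereas \<open>U\<close> does not charge \<open>E\<close>.
\<close>

definition potential_integral ::
  "'a measure \<Rightarrow> (real \<Rightarrow> 'a \<Rightarrow> real) \<Rightarrow> (real \<Rightarrow> real) \<Rightarrow> real \<Rightarrow> real set \<Rightarrow> ennreal" where
  "potential_integral M \<xi> f x E =
     (\<integral>\<^sup>+ y\<in>{y. x + y \<in> E}. ennreal (f (x + y)) \<partial>potential_measure M \<xi>)"

text \<open>
  \<^const>\<open>measure_of\<close> returns the null measure unless its argument is countably additive; the
  following shows that this does not happen here.
\<close>

lemma sets_potential_measure [simp, measurable_cong]: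
  "sets (potential_measure M \<xi>) = sets borel"
  unfolding potential_measure_def using sets.sigma_sets_eq[of borel] by (simp add: sets_measure_of)

lemma space_potential_measure [simp]: "space (potential_measure M \<xi>) = UNIV"
  unfolding potential_measure_def by (simp add: space_measure_of)

context levy_process
begin

lemma jointly_measurable_version:
  obtains \<eta> :: "real \<Rightarrow> 'a \<Rightarrow> real"
  where "case_prod \<eta> \<in> borel_measurable (lborel \<Otimes>\<^sub>M M)"
    and "AE \<omega> in M. \<forall>s\<ge>0. \<eta> s \<omega> = \<xi> s \<omega>"
proof -
  define \<tau> :: "nat \<Rightarrow> int \<Rightarrow> real" where "\<tau> n k = max 0 ((of_int k + 1) / real (Suc n))" for n k
  define X where "X n s \<omega> = \<xi> (\<tau> n \<lfloor>s * real (Suc n)\<rfloor>) \<omega>" for n s \<omega>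
  define \<eta> where "\<eta> s \<omega> = lim (\<lambda>n. X n s \<omega>)" for s \<omega>
  have meas: "(\<lambda>p. \<xi> (\<tau> n k) (snd p)) \<in> borel_measurable (lborel \<Otimes>\<^sub>M M)" for n k
    using random_variable_levy[of "\<tau> n k"] by (auto simp: \<tau>_def)
  have "(\<lambda>p. \<xi> (\<tau> n \<lfloor>fst p * real (Suc n)\<rfloor>) (snd p)) \<in> borel_measurable (lborel \<Otimes>\<^sub>M M)" for n
    by (rule measurable_compose_countable[OF meas]) measurable
  hence X: "(\<lambda>p. X n (fst p) (snd p)) \<in> borel_measurable (lborel \<Otimes>\<^sub>M M)" for n
    by (simp add: X_def)
  have 1: "case_prod \<eta> \<in> borel_measurable (lborel \<Otimes>\<^sub>M M)"
    unfolding \<eta>_def case_prod_beta by (rule borel_measurable_lim_metric[OF X])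
  have 2: "AE \<omega> in M. \<forall>s\<ge>0. \<eta> s \<omega> = \<xi> s \<omega>"
    using cadlag_paths
  proof eventually_elim
    case (elim \<omega>)
    show ?case
    proof (intro allI impI)
      fix s :: real assume s: "0 \<le> s"
      have lim: "((\<lambda>r. \<xi> r \<omega>) \<longlongrightarrow> \<xi> s \<omega>) (at_right s)"
        using elim s by (auto simp: continuous_within)
      have gt: "s < \<tau> n \<lfloor>s * real (Suc n)\<rfloor>" for n
      proof -
        have "s * real (Suc n) < of_int \<lfloor>s * real (Suc n)\<rfloor> + 1" by linarith
        hence "s < (of_int \<lfloor>s * real (Suc n)\<rfloor> + 1) / real (Suc n)"
          by (subst pos_less_divide_eq) auto
        thus ?thesis unfolding \<tau>_def by linarith
      qed
      have le: "\<tau> n \<lfloor>s * real (Suc n)\<rfloor> \<le> s + 1 / real (Suc n)" for n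
      proof -
        have "of_int \<lfloor>s * real (Suc n)\<rfloor> + 1 \<le> s * real (Suc n) + 1" by linarith
        hence "(of_int \<lfloor>s * real (Suc n)\<rfloor> + 1) / real (Suc n) \<le> (s * real (Suc n) + 1) / real (Suc n)"
          by (rule divide_right_mono) simp
        also have "\<dots> = s + 1 / real (Suc n)" by (simp add: field_simps)
        finally show ?thesis using s unfolding \<tau>_def by simp
      qed
      have "(\<lambda>n. \<tau> n \<lfloor>s * real (Suc n)\<rfloor>) \<longlonglongrightarrow> s"
      proof (rule tendsto_sandwich)
        show "(\<lambda>n. s) \<longlonglongrightarrow> s" by simp
        show "(\<lambda>n. s + 1 / real (Suc n)) \<longlonglongrightarrow> s"
          using tendsto_add[OF tendsto_const LIMSEQ_inverse_real_of_nat, of s]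
          by (simp add: inverse_eq_divide)
      qed (use gt le in \<open>auto intro: less_imp_le always_eventually\<close>)
      hence "filterlim (\<lambda>n. \<tau> n \<lfloor>s * real (Suc n)\<rfloor>) (at_right s) sequentially"
        unfolding filterlim_at using gt by (intro conjI always_eventually allI) (auto simp del: of_nat_Suc simp: less_imp_neq[THEN not_sym])
      from filterlim_compose[OF lim this]
      have "(\<lambda>n. \<xi> (\<tau> n \<lfloor>s * real (Suc n)\<rfloor>) \<omega>) \<longlonglongrightarrow> \<xi> s \<omega>" .
      thus "\<eta> s \<omega> = \<xi> s \<omega>" by (simp add: \<eta>_def X_def limI)
    qed
  qed
  from 1 2 show ?thesis by (rule that)
qed

lemma emeasure_potential_measure:
  assumes A: "A \<in> sets borel"
  shows "emeasure (potential_measure M \<xi>) A =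
           (\<integral>\<^sup>+ s\<in>{0..}. emeasure M {\<omega> \<in> space M. \<xi> s \<omega> \<in> A} \<partial>lborel)"
proof -
  let ?\<mu> = "\<lambda>A. \<integral>\<^sup>+ s\<in>{0..}. emeasure M {\<omega> \<in> space M. \<xi> s \<omega> \<in> A} \<partial>lborel"
  obtain \<eta> where \<eta>: "case_prod \<eta> \<in> borel_measurable (lborel \<Otimes>\<^sub>M M)"
    and eq: "AE \<omega> in M. \<forall>s\<ge>0. \<eta> s \<omega> = \<xi> s \<omega>"
    by (rule jointly_measurable_version)
  have meas: "(\<lambda>s. emeasure M {\<omega> \<in> space M. \<eta> s \<omega> \<in> B}) \<in> borel_measurable lborel"
    if B: "B \<in> sets borel" for B
  proof -
    have "case_prod \<eta> -` B \<inter> space (lborel \<Otimes>\<^sub>M M) \<in> sets (lborel \<Otimes>\<^sub>M M)"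
      using \<eta> B by (rule measurable_sets)
    from measurable_emeasure_Pair[OF this]
    show ?thesis
      by (rule measurable_cong[THEN iffD1, rotated])
         (auto intro!: arg_cong[of _ _ "emeasure M"] simp: space_pair_measure)
  qed
  have eq': "emeasure M {\<omega> \<in> space M. \<xi> s \<omega> \<in> B} = emeasure M {\<omega> \<in> space M. \<eta> s \<omega> \<in> B}"
    if B: "B \<in> sets borel" and s: "0 \<le> s" for B s
  proof (rule emeasure_eq_AE)
    show "AE \<omega> in M. (\<omega> \<in> {\<omega> \<in> space M. \<xi> s \<omega> \<in> B}) = (\<omega> \<in> {\<omega> \<in> space M. \<eta> s \<omega> \<in> B})"
      using eq by eventually_elim (use s in auto)
    have [measurable]: "\<xi> s \<in> borel_measurable M" using s by (rule random_variable_levy)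
    have [measurable]: "\<eta> s \<in> borel_measurable M"
      using measurable_Pair2[OF \<eta>, of s] by simp
    note B[measurable]
    show "{\<omega> \<in> space M. \<xi> s \<omega> \<in> B} \<in> sets M" by measurable
    show "{\<omega> \<in> space M. \<eta> s \<omega> \<in> B} \<in> sets M" by measurable
  qed
  have meas': "(\<lambda>s. emeasure M {\<omega> \<in> space M. \<xi> s \<omega> \<in> B} * indicator {0..} s)
      \<in> borel_measurable lborel" if B: "B \<in> sets borel" for B
  proof -
    have "(\<lambda>s. emeasure M {\<omega> \<in> space M. \<eta> s \<omega> \<in> B} * indicator {0..} s) \<in> borel_measurable lborel"
      using meas[OF B] by measurable
    thus ?thesis
      by (rule measurable_cong[THEN iffD1, rotated]) (auto simp: eq'[OF B] indicator_def)
  qed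
  have "countably_additive (sets borel) ?\<mu>"
  proof (rule countably_additiveI)
    fix B :: "nat \<Rightarrow> real set"
    assume B: "range B \<subseteq> sets borel" and disj: "disjoint_family B"
    have "(\<Sum>i. emeasure M {\<omega> \<in> space M. \<xi> s \<omega> \<in> B i} * indicator {0..} s) =
          emeasure M {\<omega> \<in> space M. \<xi> s \<omega> \<in> (\<Union>i. B i)} * indicator {0..} s" for s :: real
    proof (cases "0 \<le> s")
      case True
      hence [measurable]: "\<xi> s \<in> borel_measurable M" by (rule random_variable_levy)
      have [measurable]: "B i \<in> sets borel" for i using B by auto
      have "(\<Sum>i. emeasure M {\<omega> \<in> space M. \<xi> s \<omega> \<in> B i}) =
            emeasure M (\<Union>i. {\<omega> \<in> space M. \<xi> s \<omega> \<in> B i})"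
      proof (rule suminf_emeasure)
        have "{\<omega> \<in> space M. \<xi> s \<omega> \<in> B i} \<in> sets M" for i by measurable
        thus "range (\<lambda>i. {\<omega> \<in> space M. \<xi> s \<omega> \<in> B i}) \<subseteq> sets M" by blast
        show "disjoint_family (\<lambda>i. {\<omega> \<in> space M. \<xi> s \<omega> \<in> B i})"
          using disj by (fastforce simp: disjoint_family_on_def)
      qed
      also have "(\<Union>i. {\<omega> \<in> space M. \<xi> s \<omega> \<in> B i}) = {\<omega> \<in> space M. \<xi> s \<omega> \<in> (\<Union>i. B i)}"
        by auto
      finally show ?thesis using True by simp
    qed simp
    moreover have "(\<Sum>i. ?\<mu> (B i)) =
        (\<integral>\<^sup>+ s. (\<Sum>i. emeasure M {\<omega> \<in> space M. \<xi> s \<omega> \<in> B i} * indicator {0..} s) \<partial>lborel)"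
      using B by (intro nn_integral_suminf[symmetric] meas') auto
    ultimately show "(\<Sum>i. ?\<mu> (B i)) = ?\<mu> (\<Union>i. B i)" by simp
  qed
  moreover have "positive (sets borel) ?\<mu>" by (simp add: positive_def)
  ultimately show ?thesis
    unfolding potential_measure_def
    using sets.sigma_algebra_axioms[of borel] A
    by (intro emeasure_measure_of_sigma) auto
qed

end

end

theory Submission
  imports Defs
begin

text \<open>
  Write \<open>A\<^sub>s\<close> for the integral of \<open>f(x + \<xi>)\<close> over \<open>[s, \<infinity>)\<close>, \<open>h(y)\<close> for the probability that the
  perpetual integral of the process started at \<open>y\<close> is at most 1, and \<open>H(y)\<close> for the probability that it
  is finite. By the Markov property, \<open>h(x + \<xi>\<^sub>s)\<close> and \<open>H(x + \<xi>\<^sub>s)\<close> are the conditional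
  probabilities of \<open>A\<^sub>s \<le> 1\<close> and of \<open>A\<^sub>s < \<infinity>\<close>, given the path up to time \<open>s\<close>.

  If \<open>E\<close> is eventually never left and \<open>f\<close> is \<open>U\<close>-integrable over \<open>E\<close>, then the time integral of
  \<open>f\<close> restricted to \<open>E\<close> has finite expectation, hence is almost surely finite. The rest of the
  integral extends over a bounded time interval, on which the cadlag path and therefore \<open>f\<close> along it
  is bounded (\<open>AE_perpetual_integral_finite\<close>).

  For the converse, \<open>E\<close> is chosen inside a superlevel set \<open>{h \<ge> \<delta>}\<close> with \<open>\<delta> > 0\<close>. Along every path,
  the times \<open>s\<close> with \<open>A\<^sub>s \<le> 1\<close> contribute at most 1 to the integral of \<open>f(x + \<xi>\<^sub>s)\<close>. Taking expectations
  and conditioning at each \<open>s\<close> shows that \<open>f h\<close> has \<open>U\<close>-integral at most 1, so the integral of \<open>f\<close> over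
  \<open>{h \<ge> \<delta>}\<close> is at most \<open>1/\<delta>\<close> (\<open>potential_integral_perpetual_prob_ge\<close>). What remains is to choose
  \<open>\<delta>\<close> and \<open>E\<close> such that the process eventually stays in \<open>E\<close>, assuming only that the perpetual
  integral is finite with positive probability.

  \<^item> If \<open>f\<close> is ultimately non-increasing, it may be replaced by a function that is non-increasing
    everywhere. Then \<open>h\<close> is non-decreasing and not identically 0, a superlevel set contains a half-line
    \<open>E = [b, \<infinity>)\<close>, and the process tends to infinity.

  \<^item> If \<open>f\<close> is continuous, let \<open>c = H(x) > 0\<close> and \<open>\<delta> = c/2\<close>. The function \<open>H\<close> is bounded and
    harmonic, so an argument of Choquet--Deny type shows \<open>H(x + \<xi>\<^sub>s) = c\<close> almost surely for each
    \<open>s\<close> (\<open>AE_perpetual_prob_finite_const\<close>). Whenever \<open>h(x + \<xi>\<^sub>s) < c/2\<close>, the conditional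
    probability of \<open>1 < A\<^sub>s < \<infinity>\<close> exceeds \<open>c/2\<close>. Since \<open>A\<close> decreases in time and is almost surely
    finite at all times or at none, stopping at the first such \<open>s\<close> after \<open>n\<close> bounds the probability
    that one exists by \<open>2/c\<close> times that of \<open>1 < A\<^sub>n < \<infinity>\<close>, which vanishes as \<open>n \<rightarrow> \<infinity>\<close>
    (\<open>perpetual_prob_maximal_inequality\<close>). This covers countably many times. By Fatou's lemma
    \<open>{h \<ge> c/2}\<close> is closed, and right-continuity of the paths extends the statement to all times.
\<close>

section \<open>Independence and stationarity of the future path\<close>

abbreviation path_space :: "(real \<Rightarrow> real) measure" where
  "path_space \<equiv> PiM {0..} (\<lambda>_. borel)"

text \<open>
  Independence of increments is available only for increasing sequences of times, whereas laws on
  the path space are determined by arbitrary finite sets of times. The monotone index function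
  \<open>idx\<close> translates from the latter to the former.
\<close>

lemma finite_set_strict_enumeration:
  fixes W :: "'b::linorder set"
  assumes "finite W" "W \<noteq> {}"
  obtains n :: nat and u :: "nat \<Rightarrow> 'b" and idx :: "'b \<Rightarrow> nat"
  where "\<And>i. i \<le> n \<Longrightarrow> u i \<in> W" "\<And>i j. i < j \<Longrightarrow> j \<le> n \<Longrightarrow> u i < u j"
    and "\<And>w. w \<in> W \<Longrightarrow> idx w \<le> n" "\<And>w. w \<in> W \<Longrightarrow> u (idx w) = w"
    and "\<And>v w. v \<in> W \<Longrightarrow> w \<in> W \<Longrightarrow> v \<le> w \<Longrightarrow> idx v \<le> idx w"
proof -
  define l where "l = sorted_list_of_set W"
  define n where "n = length l - 1"
  have set_l: "set l = W" using assms by (simp add: l_def)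
  have len: "length l = Suc n"
    using assms(2) set_l unfolding n_def by (cases l) auto
  have lt: "l ! i < l ! j" if "i < j" "j \<le> n" for i j
    using that len by (intro sorted_wrt_nth_less[of "(<)"]) (auto simp: l_def)
  have "\<forall>w\<in>W. \<exists>i. i \<le> n \<and> l ! i = w"
    by (auto simp: set_l[symmetric] in_set_conv_nth len less_Suc_eq_le)
  from bchoice[OF this] obtain idx where idx: "\<forall>w\<in>W. idx w \<le> n \<and> l ! idx w = w" ..
  show thesis
  proof (rule that[of n "(!) l" idx])
    show "l ! i \<in> W" if "i \<le> n" for i
      using that len by (auto simp: set_l[symmetric])
    show "idx v \<le> idx w" if "v \<in> W" "w \<in> W" "v \<le> w" for v w
    proof (rule ccontr)
      assume "\<not> idx v \<le> idx w"
      hence "l ! idx w < l ! idx v" using idx that by (intro lt) auto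
      thus False using idx that by auto
    qed
  qed (use lt idx in auto)
qed

context levy_process
begin

text \<open>
  The path after time \<open>t\<close>, relative to its position at \<open>t\<close>. Subtracting \<open>\<xi> 0\<close> also when \<open>t = 0\<close>
  makes the paths for all \<open>t\<close> start at exactly 0, although \<open>\<xi> 0 = 0\<close> holds only almost surely;
  restricting to \<open>{0..}\<close> makes them points of the product space.
\<close>

definition shifted_path :: "real \<Rightarrow> 'a \<Rightarrow> real \<Rightarrow> real" where
  "shifted_path t \<omega> = (\<lambda>s\<in>{0..}. \<xi> (t + s) \<omega> - \<xi> t \<omega>)"

lemma measurable_shifted_path: "0 \<le> t \<Longrightarrow> shifted_path t \<in> measurable M path_space"
  unfolding shifted_path_def
  by (intro measurable_restrict borel_measurable_diff random_variable_levy) auto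

lemma increment_decomposition:
  fixes u :: "nat \<Rightarrow> real"
  assumes "i \<le> j"
  shows "\<xi> (u j) \<omega> - \<xi> (u i) \<omega> = (\<Sum>k\<in>{i..<j}. \<xi> (u (Suc k)) \<omega> - \<xi> (u k) \<omega>)"
  using sum_Suc_diff'[OF assms, of "\<lambda>k. \<xi> (u k) \<omega>"] by simp

text \<open>
  On a common enumeration of all times involved, the past is a function of the increments before \<open>t\<close>
  and the future is a function of those after \<open>t\<close>.
\<close>

lemma indep_past_future_finite:
  assumes t: "0 \<le> t" and J: "finite J" "J \<subseteq> {0..t}" and K: "finite K" "K \<subseteq> {0..}"
  shows "indep_var (PiM J (\<lambda>_. borel)) (\<lambda>\<omega>. \<lambda>j\<in>J. \<xi> j \<omega> - \<xi> 0 \<omega>)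
                   (PiM K (\<lambda>_. borel)) (\<lambda>\<omega>. \<lambda>k\<in>K. \<xi> (t + k) \<omega> - \<xi> t \<omega>)"
proof -
  let ?W = "insert 0 (insert t (J \<union> (+) t ` K))"
  have fin: "finite ?W" and ne: "?W \<noteq> {}" using J K by auto
  obtain n :: nat and u idx where u: "\<And>i. i \<le> n \<Longrightarrow> u i \<in> ?W"
      "\<And>i j. i < j \<Longrightarrow> j \<le> n \<Longrightarrow> u i < u j"
    and idx: "\<And>w. w \<in> ?W \<Longrightarrow> idx w \<le> n" "\<And>w. w \<in> ?W \<Longrightarrow> u (idx w) = w"
    and mono: "\<And>v w. v \<in> ?W \<Longrightarrow> w \<in> ?W \<Longrightarrow> v \<le> w \<Longrightarrow> idx v \<le> idx w"
    by (rule finite_set_strict_enumeration[OF fin ne]) (rule that; assumption)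
  define X where "X i \<omega> = \<xi> (u (Suc i)) \<omega> - \<xi> (u i) \<omega>" for i \<omega>
  have pos: "0 \<le> u 0"
  proof -
    have "u 0 \<in> ?W" by (rule u(1)) simp
    thus ?thesis using t J(2) K(2) by (auto simp: subset_iff)
  qed
  have "indep_vars (\<lambda>_. borel) X {..<n}"
    unfolding X_def by (rule independent_increments) (use pos u(2) in auto)
  hence 1: "indep_var (PiM {..<idx t} (\<lambda>_. borel)) (\<lambda>\<omega>. restrict (\<lambda>i. X i \<omega>) {..<idx t})
      (PiM {idx t..<n} (\<lambda>_. borel)) (\<lambda>\<omega>. restrict (\<lambda>i. X i \<omega>) {idx t..<n})"
    by (rule indep_var_restrict) (use idx(1)[of t] in auto)
  define Y1 where "Y1 v = (\<lambda>j\<in>J. \<Sum>i\<in>{idx 0..<idx j}. v i)" for v :: "nat \<Rightarrow> real"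
  define Y2 where "Y2 v = (\<lambda>k\<in>K. \<Sum>i\<in>{idx t..<idx (t + k)}. v i)" for v :: "nat \<Rightarrow> real"
  have le1: "idx 0 \<le> idx j" "idx j \<le> idx t" if "j \<in> J" for j
    using that J by (auto intro!: mono)
  have le2: "idx t \<le> idx (t + k)" "idx (t + k) \<le> n" if "k \<in> K" for k
    using that K by (auto intro!: mono idx)
  have Y1: "Y1 \<in> measurable (PiM {..<idx t} (\<lambda>_. borel)) (PiM J (\<lambda>_. borel))"
    unfolding Y1_def using le1
    by (intro measurable_restrict borel_measurable_sum measurable_component_singleton) force
  have Y2: "Y2 \<in> measurable (PiM {idx t..<n} (\<lambda>_. borel)) (PiM K (\<lambda>_. borel))"
    unfolding Y2_def using le2
    by (intro measurable_restrict borel_measurable_sum measurable_component_singleton) force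
  have Y1_eq: "Y1 \<circ> (\<lambda>\<omega>. restrict (\<lambda>i. X i \<omega>) {..<idx t}) = (\<lambda>\<omega>. \<lambda>j\<in>J. \<xi> j \<omega> - \<xi> 0 \<omega>)"
  proof (rule ext, unfold o_def Y1_def, rule restrict_ext)
    fix \<omega> j assume j: "j \<in> J"
    have "(\<Sum>i\<in>{idx 0..<idx j}. restrict (\<lambda>i. X i \<omega>) {..<idx t} i) = (\<Sum>i\<in>{idx 0..<idx j}. X i \<omega>)"
      using le1[OF j] by (intro sum.cong) auto
    also have "\<dots> = \<xi> (u (idx j)) \<omega> - \<xi> (u (idx 0)) \<omega>"
      unfolding X_def by (rule increment_decomposition[symmetric]) (rule le1[OF j])
    finally show "(\<Sum>i\<in>{idx 0..<idx j}. restrict (\<lambda>i. X i \<omega>) {..<idx t} i) = \<xi> j \<omega> - \<xi> 0 \<omega>"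
      using j by (simp add: idx)
  qed
  have Y2_eq: "Y2 \<circ> (\<lambda>\<omega>. restrict (\<lambda>i. X i \<omega>) {idx t..<n}) = (\<lambda>\<omega>. \<lambda>k\<in>K. \<xi> (t + k) \<omega> - \<xi> t \<omega>)"
  proof (rule ext, unfold o_def Y2_def, rule restrict_ext)
    fix \<omega> k assume k: "k \<in> K"
    have "(\<Sum>i\<in>{idx t..<idx (t + k)}. restrict (\<lambda>i. X i \<omega>) {idx t..<n} i)
        = (\<Sum>i\<in>{idx t..<idx (t + k)}. X i \<omega>)"
      using le2[OF k] by (intro sum.cong) auto
    also have "\<dots> = \<xi> (u (idx (t + k))) \<omega> - \<xi> (u (idx t)) \<omega>"
      unfolding X_def by (rule increment_decomposition[symmetric]) (rule le2[OF k])
    finally show "(\<Sum>i\<in>{idx t..<idx (t + k)}. restrict (\<lambda>i. X i \<omega>) {idx t..<n} i)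
        = \<xi> (t + k) \<omega> - \<xi> t \<omega>"
      using k by (simp add: idx)
  qed
  show ?thesis by (rule indep_var_compose[OF 1 Y1 Y2, unfolded Y1_eq Y2_eq])
qed

text \<open>
  The right-hand side does not depend on \<open>t\<close>, which is how stationarity of single increments yields
  stationarity of the whole path.
\<close>

lemma distr_increments_shift:
  fixes u :: "nat \<Rightarrow> real"
  assumes t: "0 \<le> t" and u0: "0 \<le> u 0" and u: "\<And>i. i < n \<Longrightarrow> u i < u (Suc i)"
  shows "distr M (PiM {..<n} (\<lambda>_. borel)) (\<lambda>\<omega>. \<lambda>i\<in>{..<n}. \<xi> (t + u (Suc i)) \<omega> - \<xi> (t + u i) \<omega>)
       = PiM {..<n} (\<lambda>i. distr M borel (\<xi> (u (Suc i) - u i)))"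
proof (cases "n = 0")
  case True
  have "(\<lambda>\<omega>. \<lambda>i\<in>{..<n}. \<xi> (t + u (Suc i)) \<omega> - \<xi> (t + u i) \<omega>) = (\<lambda>\<omega> k. undefined)"
    using True by (simp add: restrict_def)
  thus ?thesis
    using True by (auto intro!: measure_eqI simp: emeasure_distr sets_PiM_empty emeasure_space_1 space_PiM)
next
  case False
  have u_nn: "0 \<le> u i" if "i \<le> n" for i
    using that by (induction i) (use u0 u in \<open>auto intro: order_trans less_imp_le simp: Suc_le_eq\<close>)
  have "indep_vars (\<lambda>_. borel) (\<lambda>i \<omega>. \<xi> (t + u (Suc i)) \<omega> - \<xi> (t + u i) \<omega>) {..<n}"
    by (rule independent_increments[of "\<lambda>i. t + u i"]) (use t u0 u in auto)
  hence "distr M (PiM {..<n} (\<lambda>_. borel)) (\<lambda>\<omega>. \<lambda>i\<in>{..<n}. \<xi> (t + u (Suc i)) \<omega> - \<xi> (t + u i) \<omega>)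
      = PiM {..<n} (\<lambda>i. distr M borel (\<lambda>\<omega>. \<xi> (t + u (Suc i)) \<omega> - \<xi> (t + u i) \<omega>))"
    using False t u_nn
    by (subst (asm) indep_vars_iff_distr_eq_PiM')
       (auto intro!: borel_measurable_diff random_variable_levy add_nonneg_nonneg)
  also have "\<dots> = PiM {..<n} (\<lambda>i. distr M borel (\<xi> (u (Suc i) - u i)))"
  proof (rule PiM_cong[OF refl])
    fix i assume "i \<in> {..<n}"
    thus "distr M borel (\<lambda>\<omega>. \<xi> (t + u (Suc i)) \<omega> - \<xi> (t + u i) \<omega>) = distr M borel (\<xi> (u (Suc i) - u i))"
      using stationary_increments[of "t + u i" "u (Suc i) - u i"] t u_nn[of i] u[of i] by simp
  qed
  finally show ?thesis .
qed

lemma distr_increments_shift_finite: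
  assumes t: "0 \<le> t" and K: "finite K" "K \<subseteq> {0..}"
  shows "distr M (PiM K (\<lambda>_. borel)) (\<lambda>\<omega>. \<lambda>k\<in>K. \<xi> (t + k) \<omega> - \<xi> t \<omega>)
       = distr M (PiM K (\<lambda>_. borel)) (\<lambda>\<omega>. \<lambda>k\<in>K. \<xi> k \<omega> - \<xi> 0 \<omega>)"
proof -
  let ?W = "insert 0 K"
  have fin: "finite ?W" and ne: "?W \<noteq> {}" using K by auto
  obtain n :: nat and u idx where u: "\<And>i. i \<le> n \<Longrightarrow> u i \<in> ?W"
      "\<And>i j. i < j \<Longrightarrow> j \<le> n \<Longrightarrow> u i < u j"
    and idx: "\<And>w. w \<in> ?W \<Longrightarrow> idx w \<le> n" "\<And>w. w \<in> ?W \<Longrightarrow> u (idx w) = w"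
    and mono: "\<And>v w. v \<in> ?W \<Longrightarrow> w \<in> ?W \<Longrightarrow> v \<le> w \<Longrightarrow> idx v \<le> idx w"
    by (rule finite_set_strict_enumeration[OF fin ne]) (rule that; assumption)
  have le: "idx 0 \<le> idx k" "idx k \<le> n" if "k \<in> K" for k
  proof -
    show "idx k \<le> n" using that idx by auto
    show "idx 0 \<le> idx k" using that K by (intro mono) auto
  qed
  have pos: "0 \<le> u 0"
  proof -
    have "u 0 \<in> ?W" by (rule u(1)) simp
    thus ?thesis using K(2) by (auto simp: subset_iff)
  qed
  define Y where "Y v = (\<lambda>k\<in>K. \<Sum>i\<in>{idx 0..<idx k}. v i)" for v :: "nat \<Rightarrow> real"
  have Y: "Y \<in> measurable (PiM {..<n} (\<lambda>_. borel)) (PiM K (\<lambda>_. borel))"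
    unfolding Y_def using le
    by (intro measurable_restrict borel_measurable_sum measurable_component_singleton) force
  have u_nn: "0 \<le> u i" if "i \<le> n" for i
    using u(2)[of 0 i] that pos by (cases "i = 0") auto
  have *: "distr M (PiM K (\<lambda>_. borel)) (\<lambda>\<omega>. \<lambda>k\<in>K. \<xi> (a + k) \<omega> - \<xi> a \<omega>) =
        distr (PiM {..<n} (\<lambda>i. distr M borel (\<xi> (u (Suc i) - u i)))) (PiM K (\<lambda>_. borel)) Y"
    if a: "0 \<le> a" for a
  proof -
    let ?X = "\<lambda>\<omega>. \<lambda>i\<in>{..<n}. \<xi> (a + u (Suc i)) \<omega> - \<xi> (a + u i) \<omega>"
    have X: "?X \<in> measurable M (PiM {..<n} (\<lambda>_. borel))"
      using a u_nn by (intro measurable_restrict borel_measurable_diff random_variable_levy) auto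
    have "(\<lambda>\<omega>. \<lambda>k\<in>K. \<xi> (a + k) \<omega> - \<xi> a \<omega>) = Y \<circ> ?X"
    proof (rule ext, unfold o_def Y_def, rule restrict_ext)
      fix \<omega> k assume k: "k \<in> K"
      have "(\<Sum>i\<in>{idx 0..<idx k}. ?X \<omega> i)
          = (\<Sum>i\<in>{idx 0..<idx k}. \<xi> (a + u (Suc i)) \<omega> - \<xi> (a + u i) \<omega>)"
        using le[OF k] by (intro sum.cong) auto
      also have "\<dots> = \<xi> (a + u (idx k)) \<omega> - \<xi> (a + u (idx 0)) \<omega>"
        by (rule increment_decomposition[symmetric, of _ _ "\<lambda>i. a + u i"]) (rule le[OF k])
      finally show "\<xi> (a + k) \<omega> - \<xi> a \<omega> = (\<Sum>i\<in>{idx 0..<idx k}. ?X \<omega> i)"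
        using k by (simp add: idx)
    qed
    hence "distr M (PiM K (\<lambda>_. borel)) (\<lambda>\<omega>. \<lambda>k\<in>K. \<xi> (a + k) \<omega> - \<xi> a \<omega>)
        = distr (distr M (PiM {..<n} (\<lambda>_. borel)) ?X) (PiM K (\<lambda>_. borel)) Y"
      using distr_distr[OF Y X] by simp
    also have "distr M (PiM {..<n} (\<lambda>_. borel)) ?X = PiM {..<n} (\<lambda>i. distr M borel (\<xi> (u (Suc i) - u i)))"
      using a pos u(2) by (intro distr_increments_shift) auto
    finally show ?thesis .
  qed
  show ?thesis using *[OF t] *[OF order_refl] by simp
qed

text \<open>
  For a fixed past event, both sides are finite measures in \<open>C\<close>, so it suffices to compare them on
  cylinder sets, where the finite-dimensional statements apply.
\<close>

lemma emeasure_past_future: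
  assumes t: "0 \<le> t" and J: "finite J" "J \<subseteq> {0..t}"
    and A: "A \<in> sets (PiM J (\<lambda>_. borel))" and C: "C \<in> sets path_space"
  shows "emeasure M {\<omega>\<in>space M. (\<lambda>j\<in>J. \<xi> j \<omega> - \<xi> 0 \<omega>) \<in> A \<and> shifted_path t \<omega> \<in> C}
       = emeasure M {\<omega>\<in>space M. (\<lambda>j\<in>J. \<xi> j \<omega> - \<xi> 0 \<omega>) \<in> A} * emeasure (distr M path_space (shifted_path 0)) C"
proof -
  let ?Y = "\<lambda>\<omega>. \<lambda>j\<in>J. \<xi> j \<omega> - \<xi> 0 \<omega>"
  have Y[measurable]: "?Y \<in> measurable M (PiM J (\<lambda>_. borel))"
    using J by (intro measurable_restrict borel_measurable_diff random_variable_levy) auto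
  note A[measurable]
  note measurable_shifted_path[OF t, measurable] measurable_shifted_path[OF order_refl, measurable]
  define B where "B = {\<omega>\<in>space M. ?Y \<omega> \<in> A}"
  have B[measurable]: "B \<in> sets M" unfolding B_def by measurable
  define P where "P = distr (density M (indicator B)) path_space (shifted_path t)"
  define Q where "Q = distr (density M (\<lambda>_. emeasure M B)) path_space (shifted_path 0)"
  have P: "emeasure P D = emeasure M {\<omega>\<in>space M. ?Y \<omega> \<in> A \<and> shifted_path t \<omega> \<in> D}"
    if D[measurable]: "D \<in> sets path_space" for D
  proof -
    have "emeasure P D = (\<integral>\<^sup>+\<omega>. indicator B \<omega> * indicator (shifted_path t -` D \<inter> space M) \<omega> \<partial>M)"
      unfolding P_def by (subst emeasure_distr) (auto simp: emeasure_density)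
    also have "\<dots> = (\<integral>\<^sup>+\<omega>. indicator {\<omega>\<in>space M. ?Y \<omega> \<in> A \<and> shifted_path t \<omega> \<in> D} \<omega> \<partial>M)"
      by (intro nn_integral_cong) (auto simp: indicator_def B_def)
    finally show ?thesis by simp
  qed
  have Q: "emeasure Q D = emeasure M B * emeasure (distr M path_space (shifted_path 0)) D"
    if D[measurable]: "D \<in> sets path_space" for D
    unfolding Q_def by (auto simp: emeasure_distr emeasure_density nn_integral_cmult)
  have "P = Q"
  proof (rule measure_eqI_PiM_infinite)
    show "sets P = sets path_space" "sets Q = sets path_space" by (simp_all add: P_def Q_def)
    have "emeasure P (space P) \<le> 1"
      by (subst P) (auto simp: P_def emeasure_le_1 intro!: sets.top)
    thus "finite_measure P" by (intro finite_measureI) (auto simp: top_unique)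
    fix D :: "real \<Rightarrow> real set" and K :: "real set"
    assume K: "finite K" "K \<subseteq> {0..}" and D: "\<And>i. i \<in> K \<Longrightarrow> D i \<in> sets borel"
    let ?Z = "\<lambda>a \<omega>. \<lambda>k\<in>K. \<xi> (a + k) \<omega> - \<xi> a \<omega>"
    have Z[measurable]: "?Z a \<in> measurable M (PiM K (\<lambda>_. borel))" if "0 \<le> a" for a
      using that K by (intro measurable_restrict borel_measurable_diff random_variable_levy) auto
    have S[measurable]: "Pi\<^sub>E K D \<in> sets (PiM K (\<lambda>_. borel))"
      using D K by (intro sets_PiM_I_finite) auto
    have mem: "shifted_path a \<omega> \<in> prod_emb {0..} (\<lambda>_. borel) K (Pi\<^sub>E K D) \<longleftrightarrow> ?Z a \<omega> \<in> Pi\<^sub>E K D" for a \<omega>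
      using K by (auto simp: prod_emb_def shifted_path_def PiE_iff restrict_def extensional_def subset_iff)
    have emb[measurable]: "prod_emb {0..} (\<lambda>_. borel) K (Pi\<^sub>E K D) \<in> sets path_space"
      using K D by (intro sets_PiM_I) auto
    have "emeasure P (prod_emb {0..} (\<lambda>_. borel) K (Pi\<^sub>E K D))
        = emeasure M {\<omega>\<in>space M. ?Y \<omega> \<in> A \<and> ?Z t \<omega> \<in> Pi\<^sub>E K D}"
      by (subst P[OF emb]) (simp only: mem)
    also have "\<dots> = emeasure M {\<omega>\<in>space M. ?Y \<omega> \<in> A} * emeasure M {\<omega>\<in>space M. ?Z t \<omega> \<in> Pi\<^sub>E K D}"
    proof -
      have "prob ((\<lambda>\<omega>. (?Y \<omega>, ?Z t \<omega>)) -` (A \<times> Pi\<^sub>E K D) \<inter> space M)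
          = prob (?Y -` A \<inter> space M) * prob (?Z t -` Pi\<^sub>E K D \<inter> space M)"
        by (rule indep_varD[OF indep_past_future_finite[OF t J K] A S])
      moreover have "(\<lambda>\<omega>. (?Y \<omega>, ?Z t \<omega>)) -` (A \<times> Pi\<^sub>E K D) \<inter> space M
          = {\<omega>\<in>space M. ?Y \<omega> \<in> A \<and> ?Z t \<omega> \<in> Pi\<^sub>E K D}" by auto
      moreover have "?Y -` A \<inter> space M = {\<omega>\<in>space M. ?Y \<omega> \<in> A}"
          "?Z t -` Pi\<^sub>E K D \<inter> space M = {\<omega>\<in>space M. ?Z t \<omega> \<in> Pi\<^sub>E K D}" by auto
      ultimately show ?thesis by (simp add: emeasure_eq_measure ennreal_mult')
    qed
    also have "emeasure M {\<omega>\<in>space M. ?Z t \<omega> \<in> Pi\<^sub>E K D} = emeasure (distr M (PiM K (\<lambda>_. borel)) (?Z t)) (Pi\<^sub>E K D)"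
      using Z[OF t] by (subst emeasure_distr) (auto intro!: arg_cong[of _ _ "emeasure M"])
    also have "distr M (PiM K (\<lambda>_. borel)) (?Z t) = distr M (PiM K (\<lambda>_. borel)) (?Z 0)"
      using distr_increments_shift_finite[OF t K] by simp
    also have "emeasure \<dots> (Pi\<^sub>E K D) = emeasure M {\<omega>\<in>space M. ?Z 0 \<omega> \<in> Pi\<^sub>E K D}"
      using Z[OF order_refl] by (subst emeasure_distr) (auto intro!: arg_cong[of _ _ "emeasure M"])
    also have "\<dots> = emeasure M {\<omega>\<in>space M. shifted_path 0 \<omega> \<in> prod_emb {0..} (\<lambda>_. borel) K (Pi\<^sub>E K D)}"
      by (simp only: mem)
    also have "\<dots> = emeasure (distr M path_space (shifted_path 0)) (prod_emb {0..} (\<lambda>_. borel) K (Pi\<^sub>E K D))"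
      by (subst emeasure_distr) (auto intro!: arg_cong[of _ _ "emeasure M"])
    finally show "emeasure P (prod_emb {0..} (\<lambda>_. borel) K (Pi\<^sub>E K D)) = emeasure Q (prod_emb {0..} (\<lambda>_. borel) K (Pi\<^sub>E K D))"
      using Q[OF emb] unfolding B_def by (simp only:)
  qed
  hence "emeasure P C = emeasure Q C" by simp
  thus ?thesis using P[OF C] Q[OF C] by (simp add: B_def)
qed

text \<open>
  The pair of past and future has a product law, whose second factor is the law of the whole path;
  the inner integral on the right thus averages over an independent copy of the path.
\<close>

lemma markov_property:
  assumes t: "0 \<le> t" and J: "finite J" "J \<subseteq> {0..t}"
    and F: "case_prod F \<in> borel_measurable (PiM J (\<lambda>_. borel) \<Otimes>\<^sub>M path_space)"
  shows "(\<integral>\<^sup>+\<omega>. F (\<lambda>j\<in>J. \<xi> j \<omega>) (shifted_path t \<omega>) \<partial>M)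
       = (\<integral>\<^sup>+\<omega>. (\<integral>\<^sup>+\<omega>'. F (\<lambda>j\<in>J. \<xi> j \<omega>) (shifted_path 0 \<omega>') \<partial>M) \<partial>M)"
proof -
  let ?Y = "\<lambda>\<omega>. \<lambda>j\<in>J. \<xi> j \<omega> - \<xi> 0 \<omega>" and ?N = "PiM J (\<lambda>_. borel) :: (real \<Rightarrow> real) measure"
  have Y[measurable]: "?Y \<in> measurable M ?N"
    using J by (intro measurable_restrict borel_measurable_diff random_variable_levy) auto
  note measurable_shifted_path[OF t, measurable] measurable_shifted_path[OF order_refl, measurable]
  note F[measurable]
  interpret Y: prob_space "distr M ?N ?Y" by (rule prob_space_distr) measurable
  interpret L: prob_space "distr M path_space (shifted_path 0)" by (rule prob_space_distr) measurable
  have eq: "distr M ?N ?Y \<Otimes>\<^sub>M distr M path_space (shifted_path 0)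
      = distr M (?N \<Otimes>\<^sub>M path_space) (\<lambda>\<omega>. (?Y \<omega>, shifted_path t \<omega>))"
  proof (rule pair_measure_eqI)
    show "sigma_finite_measure (distr M ?N ?Y)" by unfold_locales
    show "sigma_finite_measure (distr M path_space (shifted_path 0))" by unfold_locales
    show "sets (distr M ?N ?Y \<Otimes>\<^sub>M distr M path_space (shifted_path 0)) =
      sets (distr M (?N \<Otimes>\<^sub>M path_space) (\<lambda>\<omega>. (?Y \<omega>, shifted_path t \<omega>)))"
      by (simp cong: sets_pair_measure_cong)
    fix A C assume "A \<in> sets (distr M ?N ?Y)" "C \<in> sets (distr M path_space (shifted_path 0))"
    hence AC[measurable]: "A \<in> sets ?N" "C \<in> sets path_space" by auto
    have "emeasure (distr M (?N \<Otimes>\<^sub>M path_space) (\<lambda>\<omega>. (?Y \<omega>, shifted_path t \<omega>))) (A \<times> C)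
        = emeasure M {\<omega>\<in>space M. ?Y \<omega> \<in> A \<and> shifted_path t \<omega> \<in> C}"
      by (subst emeasure_distr) (auto intro!: arg_cong[of _ _ "emeasure M"])
    also have "\<dots> = emeasure M {\<omega>\<in>space M. ?Y \<omega> \<in> A} * emeasure (distr M path_space (shifted_path 0)) C"
      by (rule emeasure_past_future[OF t J AC])
    also have "emeasure M {\<omega>\<in>space M. ?Y \<omega> \<in> A} = emeasure (distr M ?N ?Y) A"
      by (subst emeasure_distr) (auto intro!: arg_cong[of _ _ "emeasure M"])
    finally show "emeasure (distr M ?N ?Y) A * emeasure (distr M path_space (shifted_path 0)) C
      = emeasure (distr M (?N \<Otimes>\<^sub>M path_space) (\<lambda>\<omega>. (?Y \<omega>, shifted_path t \<omega>))) (A \<times> C)" by (rule sym)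
  qed
  have "(\<integral>\<^sup>+\<omega>. F (\<lambda>j\<in>J. \<xi> j \<omega>) (shifted_path t \<omega>) \<partial>M) = (\<integral>\<^sup>+\<omega>. F (?Y \<omega>) (shifted_path t \<omega>) \<partial>M)"
    by (intro nn_integral_cong_AE, use start_zero in eventually_elim) simp
  also have "\<dots> = (\<integral>\<^sup>+z. case_prod F z \<partial>distr M (?N \<Otimes>\<^sub>M path_space) (\<lambda>\<omega>. (?Y \<omega>, shifted_path t \<omega>)))"
    by (subst nn_integral_distr) auto
  also have "\<dots> = (\<integral>\<^sup>+z. case_prod F z \<partial>(distr M ?N ?Y \<Otimes>\<^sub>M distr M path_space (shifted_path 0)))"
    by (simp only: eq)
  also have "\<dots> = (\<integral>\<^sup>+y. \<integral>\<^sup>+p. F y p \<partial>distr M path_space (shifted_path 0) \<partial>distr M ?N ?Y)"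
    by (rule L.nn_integral_fst[symmetric, of "case_prod F", unfolded prod.case])
       (simp only: measurable_distr_eq1 F measurable_cong_sets[OF sets_pair_measure_cong[OF sets_distr sets_distr] refl])
  also have "\<dots> = (\<integral>\<^sup>+y. \<integral>\<^sup>+\<omega>'. F y (shifted_path 0 \<omega>') \<partial>M \<partial>distr M ?N ?Y)"
    by (intro nn_integral_cong nn_integral_distr) (auto simp: space_distr)
  also have "\<dots> = (\<integral>\<^sup>+\<omega>. \<integral>\<^sup>+\<omega>'. F (?Y \<omega>) (shifted_path 0 \<omega>') \<partial>M \<partial>M)"
    by (subst nn_integral_distr) (auto intro!: borel_measurable_nn_integral)
  also have "\<dots> = (\<integral>\<^sup>+\<omega>. \<integral>\<^sup>+\<omega>'. F (\<lambda>j\<in>J. \<xi> j \<omega>) (shifted_path 0 \<omega>') \<partial>M \<partial>M)"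
    by (intro nn_integral_cong_AE, use start_zero in eventually_elim) simp
  finally show ?thesis .
qed

end

section \<open>Integrals along right-continuous paths\<close>

text \<open>
  An approximation of \<open>s\<close> from the right that, for fixed \<open>n\<close>, takes countably many values. The maximum with 0 keeps it
  inside the index set of the path space also for negative \<open>s\<close>.
\<close>

definition grid_point :: "nat \<Rightarrow> real \<Rightarrow> real" where
  "grid_point n s = max 0 ((of_int \<lfloor>s * real (Suc n)\<rfloor> + 1) / real (Suc n))"

text \<open>
  A jointly measurable function of time and path that recovers every right-continuous path on \<open>{0..}\<close>.
  Evaluation \<open>p s\<close> itself is not jointly measurable on the product space.
\<close>

definition right_limit :: "(real \<Rightarrow> real) \<Rightarrow> real \<Rightarrow> real" where
  "right_limit p s = lim (\<lambda>n. p (grid_point n s))"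

lemma grid_point_at_right:
  assumes s: "0 \<le> s"
  shows "filterlim (\<lambda>n. grid_point n s) (at_right s) sequentially"
proof -
  have gt: "s < grid_point n s" for n
  proof -
    have "s * real (Suc n) < of_int \<lfloor>s * real (Suc n)\<rfloor> + 1" by linarith
    hence "s < (of_int \<lfloor>s * real (Suc n)\<rfloor> + 1) / real (Suc n)"
      by (subst pos_less_divide_eq) auto
    thus ?thesis unfolding grid_point_def by linarith
  qed
  have le: "grid_point n s \<le> s + 1 / real (Suc n)" for n
  proof -
    have "(of_int \<lfloor>s * real (Suc n)\<rfloor> + 1) / real (Suc n) \<le> (s * real (Suc n) + 1) / real (Suc n)"
      by (intro divide_right_mono) auto
    also have "\<dots> = s + 1 / real (Suc n)" by (simp add: field_simps)
    finally show ?thesis using s unfolding grid_point_def by simp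
  qed
  have "(\<lambda>n. grid_point n s) \<longlonglongrightarrow> s"
  proof (rule tendsto_sandwich[of "\<lambda>_. s" _ _ "\<lambda>n. s + 1 / real (Suc n)"])
    show "(\<lambda>n. s + 1 / real (Suc n)) \<longlonglongrightarrow> s"
      using tendsto_add[OF tendsto_const LIMSEQ_inverse_real_of_nat, of s]
      by (simp add: inverse_eq_divide)
  qed (use gt le in \<open>auto intro: less_imp_le always_eventually\<close>)
  thus ?thesis unfolding filterlim_at
    using gt by (auto intro!: always_eventually simp: less_imp_neq[THEN not_sym])
qed

lemma right_limit_eq:
  assumes "0 \<le> s" "continuous (at_right s) p"
  shows "right_limit p s = p s"
  using filterlim_compose[OF assms(2)[unfolded continuous_within] grid_point_at_right[OF assms(1)]]
  unfolding right_limit_def by (rule limI)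

lemma measurable_right_limit:
  "(\<lambda>(s, p). right_limit p s) \<in> borel_measurable (borel \<Otimes>\<^sub>M path_space)"
proof -
  define \<tau> :: "nat \<Rightarrow> int \<Rightarrow> real" where "\<tau> n k = max 0 ((of_int k + 1) / real (Suc n))" for n k
  have meas: "(\<lambda>z::real \<times> (real \<Rightarrow> real). snd z (\<tau> n k)) \<in> borel_measurable (borel \<Otimes>\<^sub>M path_space)" for n k
  proof -
    have "(\<lambda>p. p (\<tau> n k)) \<in> borel_measurable path_space"
      by (rule measurable_component_singleton) (simp add: \<tau>_def)
    from measurable_compose[OF measurable_snd this] show ?thesis .
  qed
  have "(\<lambda>z. snd z (\<tau> n \<lfloor>fst z * real (Suc n)\<rfloor>)) \<in> borel_measurable (borel \<Otimes>\<^sub>M path_space)" for n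
    by (rule measurable_compose_countable[OF meas]) measurable
  hence "(\<lambda>z. snd z (grid_point n (fst z))) \<in> borel_measurable (borel \<Otimes>\<^sub>M path_space)" for n
    by (simp only: grid_point_def \<tau>_def)
  thus ?thesis
    unfolding right_limit_def case_prod_beta by (rule borel_measurable_lim_metric)
qed

lemma measurable_right_limit' [measurable (raw)]:
  assumes h: "h \<in> borel_measurable N" "k \<in> measurable N path_space"
  shows "(\<lambda>z. right_limit (k z) (h z)) \<in> borel_measurable N"
  using measurable_compose[OF measurable_Pair[OF h] measurable_right_limit] by simp

definition tail_integral :: "(real \<Rightarrow> real) \<Rightarrow> real \<Rightarrow> real \<Rightarrow> (real \<Rightarrow> real) \<Rightarrow> ennreal" where
  "tail_integral g t y p = (\<integral>\<^sup>+ s\<in>{t..}. ennreal (g (y + right_limit p s)) \<partial>lborel)"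

lemma measurable_tail_integral:
  assumes [measurable]: "g \<in> borel_measurable borel"
  shows "(\<lambda>(y, p). tail_integral g t y p) \<in> borel_measurable (borel \<Otimes>\<^sub>M path_space)"
proof -
  note measurable_right_limit[measurable]
  have "(\<lambda>z. case z of ((y, p), s) \<Rightarrow> right_limit p s) \<in> borel_measurable ((borel \<Otimes>\<^sub>M path_space) \<Otimes>\<^sub>M lborel)"
    using measurable_compose[OF _ measurable_right_limit,
        of "\<lambda>z. (snd z, snd (fst z))" "(borel \<Otimes>\<^sub>M path_space) \<Otimes>\<^sub>M lborel"]
    by (simp add: case_prod_beta)
  hence [measurable]: "(\<lambda>z. right_limit (snd (fst z)) (snd z)) \<in> borel_measurable ((borel \<Otimes>\<^sub>M path_space) \<Otimes>\<^sub>M lborel)"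
    by (simp add: case_prod_beta)
  have "(\<lambda>z. ennreal (g (fst (fst z) + right_limit (snd (fst z)) (snd z))) * indicator {t..} (snd z))
      \<in> borel_measurable ((borel \<Otimes>\<^sub>M path_space) \<Otimes>\<^sub>M lborel)"
    by measurable
  hence "(\<lambda>z. \<integral>\<^sup>+s. ennreal (g (fst z + right_limit (snd z) s)) * indicator {t..} s \<partial>lborel)
      \<in> borel_measurable (borel \<Otimes>\<^sub>M path_space)"
    by (intro lborel.borel_measurable_nn_integral) (simp add: case_prod_beta)
  thus ?thesis by (simp add: tail_integral_def case_prod_beta)
qed

lemma measurable_tail_integral' [measurable (raw)]:
  assumes g: "g \<in> borel_measurable borel" and h: "h \<in> borel_measurable N" "k \<in> measurable N path_space"
  shows "(\<lambda>z. tail_integral g t (h z) (k z)) \<in> borel_measurable N"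
  using measurable_compose[OF measurable_Pair[OF h] measurable_tail_integral[OF g]] by simp

lemma tail_integral_antimono: "s \<le> t \<Longrightarrow> tail_integral g t y p \<le> tail_integral g s y p"
  unfolding tail_integral_def by (intro nn_integral_mono) (auto simp: indicator_def)

text \<open>
  The tails are the masses of the decreasing sets \<open>[n, \<infinity>)\<close> under a measure that is finite on the
  first of them.
\<close>

lemma tail_integral_tendsto_zero:
  assumes [measurable]: "g \<in> borel_measurable borel" "p \<in> space path_space"
    and fin: "tail_integral g 0 y p < \<infinity>"
  shows "(\<lambda>n. tail_integral g (real n) y p) \<longlonglongrightarrow> 0"
proof -
  let ?\<phi> = "\<lambda>s. ennreal (g (y + right_limit p s))"
  have [measurable]: "?\<phi> \<in> borel_measurable lborel" by measurable
  have eq: "tail_integral g t y p = emeasure (density lborel ?\<phi>) {t..}" for t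
    unfolding tail_integral_def by (subst emeasure_density) auto
  have "(\<lambda>n. emeasure (density lborel ?\<phi>) {real n..}) \<longlonglongrightarrow> emeasure (density lborel ?\<phi>) (\<Inter>n. {real n..})"
  proof (rule Lim_emeasure_decseq)
    show "emeasure (density lborel ?\<phi>) {real n..} \<noteq> \<infinity>" for n
      using order.strict_trans1[OF tail_integral_antimono fin, of "real n"] unfolding eq by auto
  qed (auto simp: decseq_def)
  moreover have "(\<Inter>n. {real n..}) = {}"
  proof -
    have "\<exists>n. r < real n" for r using reals_Archimedean2 by blast
    thus ?thesis by (fastforce simp: not_le[symmetric])
  qed
  ultimately show ?thesis by (simp add: eq)
qed

section \<open>Perpetual integrals and the Markov property\<close>

context levy_process
begin

lemma shifted_path_in_space [measurable, simp]: "shifted_path t \<omega> \<in> space path_space"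
  by (simp add: shifted_path_def space_PiM)

lemma measurable_shifted_path_zero [measurable]: "shifted_path 0 \<in> measurable M path_space"
  by (rule measurable_shifted_path) simp

lemma AE_right_limit_shifted_path:
  "AE \<omega> in M. \<forall>t\<ge>0. \<forall>s\<ge>0. right_limit (shifted_path t \<omega>) s = \<xi> (t + s) \<omega> - \<xi> t \<omega>"
  using cadlag_paths
proof eventually_elim
  case (elim \<omega>)
  show ?case
  proof (intro allI impI)
    fix t s :: real assume t: "0 \<le> t" and s: "0 \<le> s"
    have "((\<lambda>r. \<xi> r \<omega>) \<longlongrightarrow> \<xi> (t + s) \<omega>) (at_right (t + s))"
      using elim t s by (simp add: continuous_within)
    also have "at_right (t + s) = filtermap (\<lambda>r. r - (- t)) (at_right s)"
      by (subst filtermap_at_right_shift) (simp add: add.commute)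
    finally have "((\<lambda>r. \<xi> (t + r) \<omega>) \<longlongrightarrow> \<xi> (t + s) \<omega>) (at_right s)"
      by (simp add: filterlim_filtermap add.commute)
    hence "((\<lambda>r. \<xi> (t + r) \<omega> - \<xi> t \<omega>) \<longlongrightarrow> \<xi> (t + s) \<omega> - \<xi> t \<omega>) (at_right s)"
      by (intro tendsto_intros)
    moreover have "eventually (\<lambda>r. \<xi> (t + r) \<omega> - \<xi> t \<omega> = shifted_path t \<omega> r) (at_right s)"
      unfolding eventually_at_right_field using s
      by (intro exI[of _ "s + 1"]) (auto simp: shifted_path_def)
    ultimately have "(shifted_path t \<omega> \<longlongrightarrow> shifted_path t \<omega> s) (at_right s)"
      using s by (subst tendsto_cong[symmetric]) (auto simp: shifted_path_def)
    hence "right_limit (shifted_path t \<omega>) s = shifted_path t \<omega> s"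
      using s by (intro right_limit_eq) (auto simp: continuous_within)
    thus "right_limit (shifted_path t \<omega>) s = \<xi> (t + s) \<omega> - \<xi> t \<omega>"
      using s by (simp add: shifted_path_def)
  qed
qed

lemma AE_right_limit_path:
  "AE \<omega> in M. \<forall>s\<ge>0. right_limit (shifted_path 0 \<omega>) s = \<xi> s \<omega>"
  using AE_right_limit_shifted_path start_zero by eventually_elim auto

text \<open>
  The exceptional null set does not depend on \<open>t\<close>, since all paths but a null set are
  right-continuous everywhere.
\<close>

lemma AE_tail_integral_shifted_path:
  assumes [measurable]: "g \<in> borel_measurable borel"
  shows "AE \<omega> in M. \<forall>t\<ge>0. \<forall>x.
    tail_integral g 0 (x + \<xi> t \<omega>) (shifted_path t \<omega>) = tail_integral g t x (shifted_path 0 \<omega>)"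
  using AE_right_limit_shifted_path AE_right_limit_path
proof eventually_elim
  case (elim \<omega>)
  show ?case
  proof (intro allI impI)
    fix t x :: real assume t: "0 \<le> t"
    let ?G = "\<lambda>s. ennreal (g (x + right_limit (shifted_path 0 \<omega>) s)) * indicator {t..} s"
    have "tail_integral g t x (shifted_path 0 \<omega>) = (\<integral>\<^sup>+s. ?G s \<partial>lborel)"
      by (simp add: tail_integral_def)
    also have "\<dots> = (\<integral>\<^sup>+s. ?G (t + s) \<partial>lborel)"
      by (subst nn_integral_real_affine[where c = 1 and t = t]) auto
    also have "\<dots> = (\<integral>\<^sup>+s. ennreal (g (x + \<xi> t \<omega> + right_limit (shifted_path t \<omega>) s)) * indicator {0..} s \<partial>lborel)"
      using elim t by (intro nn_integral_cong) (auto simp: indicator_def)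
    finally show "tail_integral g 0 (x + \<xi> t \<omega>) (shifted_path t \<omega>) = tail_integral g t x (shifted_path 0 \<omega>)"
      by (simp add: tail_integral_def)
  qed
qed

lemma AE_perpetual_integral_eq:
  "AE \<omega> in M. perpetual_integral \<xi> g x \<omega> = tail_integral g 0 x (shifted_path 0 \<omega>)"
  using AE_right_limit_path
  by eventually_elim
     (auto simp: perpetual_integral_def tail_integral_def indicator_def intro!: nn_integral_cong)

text \<open>
  With the process started at \<open>y\<close>, this is the probability that the perpetual integral lies in \<open>B\<close>.
  The cases of interest are \<open>B = {..1}\<close> and \<open>B = {..<\<infinity>}\<close>, called \<open>h\<close> and \<open>H\<close> above.
\<close>

definition perpetual_prob :: "(real \<Rightarrow> real) \<Rightarrow> ennreal set \<Rightarrow> real \<Rightarrow> real" where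
  "perpetual_prob g B y = prob {\<omega>\<in>space M. tail_integral g 0 y (shifted_path 0 \<omega>) \<in> B}"

lemma perpetual_prob_bounds: "0 \<le> perpetual_prob g B y" "perpetual_prob g B y \<le> 1"
  by (auto simp: perpetual_prob_def)

lemma ennreal_perpetual_prob:
  assumes [measurable]: "g \<in> borel_measurable borel" "B \<in> sets borel"
  shows "ennreal (perpetual_prob g B y) = (\<integral>\<^sup>+\<omega>. indicator B (tail_integral g 0 y (shifted_path 0 \<omega>)) \<partial>M)"
proof -
  have "ennreal (perpetual_prob g B y)
      = (\<integral>\<^sup>+\<omega>. indicator {\<omega>\<in>space M. tail_integral g 0 y (shifted_path 0 \<omega>) \<in> B} \<omega> \<partial>M)"
    unfolding perpetual_prob_def emeasure_eq_measure[symmetric] by (subst nn_integral_indicator) auto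
  also have "\<dots> = (\<integral>\<^sup>+\<omega>. indicator B (tail_integral g 0 y (shifted_path 0 \<omega>)) \<partial>M)"
    by (intro nn_integral_cong) (auto simp: indicator_def)
  finally show ?thesis .
qed

lemma measurable_perpetual_prob [measurable]:
  assumes [measurable]: "g \<in> borel_measurable borel" "B \<in> sets borel"
  shows "perpetual_prob g B \<in> borel_measurable borel"
proof -
  have "(\<lambda>y. \<integral>\<^sup>+\<omega>. indicator B (tail_integral g 0 y (shifted_path 0 \<omega>)) \<partial>M) \<in> borel_measurable borel"
    by measurable
  hence "(\<lambda>y. enn2real (ennreal (perpetual_prob g B y))) \<in> borel_measurable borel"
    by (subst ennreal_perpetual_prob) measurable
  thus ?thesis by (simp add: perpetual_prob_bounds)
qed

text \<open>
  This says that \<open>perpetual_prob g B (x + \<xi> t)\<close> is the conditional probability, given the path up to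
  \<open>t\<close>, that the remaining integral lies in \<open>B\<close>. Weights \<open>W\<close> that see finitely many past times are
  enough to express first passage within a finite set of times.
\<close>

lemma markov_perpetual_prob:
  assumes t: "0 \<le> t" and J: "finite J" "J \<subseteq> {0..t}" "t \<in> J"
    and [measurable]: "W \<in> borel_measurable (PiM J (\<lambda>_. borel))"
      "g \<in> borel_measurable borel" "B \<in> sets borel"
  shows "(\<integral>\<^sup>+\<omega>. W (\<lambda>j\<in>J. \<xi> j \<omega>) * indicator B (tail_integral g t x (shifted_path 0 \<omega>)) \<partial>M)
       = (\<integral>\<^sup>+\<omega>. W (\<lambda>j\<in>J. \<xi> j \<omega>) * ennreal (perpetual_prob g B (x + \<xi> t \<omega>)) \<partial>M)"
proof -
  have [measurable]: "(\<lambda>v. v t) \<in> borel_measurable (PiM J (\<lambda>_. borel))"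
    using J(3) by (rule measurable_component_singleton)
  have "(\<integral>\<^sup>+\<omega>. W (\<lambda>j\<in>J. \<xi> j \<omega>) * indicator B (tail_integral g t x (shifted_path 0 \<omega>)) \<partial>M)
      = (\<integral>\<^sup>+\<omega>. W (\<lambda>j\<in>J. \<xi> j \<omega>)
          * indicator B (tail_integral g 0 (x + (\<lambda>j\<in>J. \<xi> j \<omega>) t) (shifted_path t \<omega>)) \<partial>M)"
    by (intro nn_integral_cong_AE, use AE_tail_integral_shifted_path[OF assms(6)] in eventually_elim)
       (use t J in simp)
  also have "\<dots> = (\<integral>\<^sup>+\<omega>. \<integral>\<^sup>+\<omega>'. W (\<lambda>j\<in>J. \<xi> j \<omega>)
          * indicator B (tail_integral g 0 (x + (\<lambda>j\<in>J. \<xi> j \<omega>) t) (shifted_path 0 \<omega>')) \<partial>M \<partial>M)"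
    by (rule markov_property[OF t J(1,2), of "\<lambda>v p. W v * indicator B (tail_integral g 0 (x + v t) p)"])
       measurable
  also have "\<dots> = (\<integral>\<^sup>+\<omega>. W (\<lambda>j\<in>J. \<xi> j \<omega>) * ennreal (perpetual_prob g B (x + \<xi> t \<omega>)) \<partial>M)"
    using J(3) by (subst nn_integral_cmult) (auto simp: ennreal_perpetual_prob)
  finally show ?thesis .
qed

text \<open>
  The potential measure is the image of Lebesgue measure on \<open>[0, \<infinity>)\<close> times \<open>M\<close> under the process.
  The two formulas are the two orders of integration. The second one uses the jointly measurable
  \<open>right_limit\<close> because the process itself agrees with a measurable one only almost surely.
\<close>

lemma nn_integral_potential_measure:
  assumes [measurable]: "k \<in> borel_measurable borel"
  shows "(\<integral>\<^sup>+y. k y \<partial>potential_measure M \<xi>)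
           = (\<integral>\<^sup>+s\<in>{0..}. (\<integral>\<^sup>+\<omega>. k (\<xi> s \<omega>) \<partial>M) \<partial>lborel)" (is "_ = ?A")
    and "(\<integral>\<^sup>+y. k y \<partial>potential_measure M \<xi>)
           = (\<integral>\<^sup>+\<omega>. (\<integral>\<^sup>+s\<in>{0..}. k (right_limit (shifted_path 0 \<omega>) s) \<partial>lborel) \<partial>M)"
proof -
  note inner_M = nn_integral_fst
  interpret pair_sigma_finite lborel M ..
  define \<eta> where "\<eta> s \<omega> = right_limit (shifted_path 0 \<omega>) s" for s \<omega>
  have [measurable]: "(\<lambda>z. \<eta> (fst z) (snd z)) \<in> borel_measurable (lborel \<Otimes>\<^sub>M M)"
    unfolding \<eta>_def by measurable
  have eq: "(\<integral>\<^sup>+\<omega>. k' (\<eta> s \<omega>) \<partial>M) = (\<integral>\<^sup>+\<omega>. k' (\<xi> s \<omega>) \<partial>M)" if "0 \<le> s"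
    for s and k' :: "real \<Rightarrow> ennreal"
    by (intro nn_integral_cong_AE, use AE_right_limit_path in eventually_elim) (use that in \<open>auto simp: \<eta>_def\<close>)
  let ?D = "density (lborel \<Otimes>\<^sub>M M) (\<lambda>z. indicator {0..} (fst z))"
  let ?N = "distr ?D borel (\<lambda>z. \<eta> (fst z) (snd z))"
  have N: "(\<integral>\<^sup>+y. k' y \<partial>?N) = (\<integral>\<^sup>+z. indicator {0..} (fst z) * k' (\<eta> (fst z) (snd z)) \<partial>(lborel \<Otimes>\<^sub>M M))"
    if [measurable]: "k' \<in> borel_measurable borel" for k' :: "real \<Rightarrow> ennreal"
    by (simp add: nn_integral_distr nn_integral_density)
  have N1: "(\<integral>\<^sup>+y. k' y \<partial>?N) = (\<integral>\<^sup>+s\<in>{0..}. (\<integral>\<^sup>+\<omega>. k' (\<xi> s \<omega>) \<partial>M) \<partial>lborel)"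
    if [measurable]: "k' \<in> borel_measurable borel" for k' :: "real \<Rightarrow> ennreal"
  proof -
    have "(\<integral>\<^sup>+y. k' y \<partial>?N) = (\<integral>\<^sup>+s. \<integral>\<^sup>+\<omega>. indicator {0..} s * k' (\<eta> s \<omega>) \<partial>M \<partial>lborel)"
      unfolding N[OF that] by (subst inner_M[symmetric]) simp_all
    also have "\<dots> = (\<integral>\<^sup>+s\<in>{0..}. (\<integral>\<^sup>+\<omega>. k' (\<xi> s \<omega>) \<partial>M) \<partial>lborel)"
      by (intro nn_integral_cong) (auto simp: eq indicator_def)
    finally show ?thesis .
  qed
  have "potential_measure M \<xi> = ?N"
  proof (rule measure_eqI)
    fix A assume "A \<in> sets (potential_measure M \<xi>)"
    hence A[measurable]: "A \<in> sets borel" by simp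
    have "emeasure ?N A = (\<integral>\<^sup>+y. indicator A y \<partial>?N)" by simp
    also have "\<dots> = (\<integral>\<^sup>+s\<in>{0..}. (\<integral>\<^sup>+\<omega>. indicator A (\<xi> s \<omega>) \<partial>M) \<partial>lborel)"
      by (rule N1) measurable
    also have "\<dots> = (\<integral>\<^sup>+s\<in>{0..}. emeasure M {\<omega>\<in>space M. \<xi> s \<omega> \<in> A} \<partial>lborel)"
    proof (intro nn_integral_cong)
      fix s :: real
      show "(\<integral>\<^sup>+\<omega>. indicator A (\<xi> s \<omega>) \<partial>M) * indicator {0..} s
          = emeasure M {\<omega>\<in>space M. \<xi> s \<omega> \<in> A} * indicator {0..} s"
      proof (cases "0 \<le> s")
        case True
        hence [measurable]: "\<xi> s \<in> borel_measurable M" by (rule random_variable_levy)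
        have "(\<integral>\<^sup>+\<omega>. indicator A (\<xi> s \<omega>) \<partial>M) = (\<integral>\<^sup>+\<omega>. indicator {\<omega>\<in>space M. \<xi> s \<omega> \<in> A} \<omega> \<partial>M)"
          by (intro nn_integral_cong) (auto simp: indicator_def)
        thus ?thesis by simp
      qed simp
    qed
    finally show "emeasure (potential_measure M \<xi>) A = emeasure ?N A"
      by (simp add: emeasure_potential_measure[OF A])
  qed simp
  hence U: "(\<integral>\<^sup>+y. k y \<partial>potential_measure M \<xi>) = (\<integral>\<^sup>+y. k y \<partial>?N)" by simp
  show "(\<integral>\<^sup>+y. k y \<partial>potential_measure M \<xi>) = ?A"
    unfolding U by (rule N1) measurable
  have "(\<integral>\<^sup>+y. k y \<partial>?N) = (\<integral>\<^sup>+\<omega>. \<integral>\<^sup>+s. indicator {0..} s * k (\<eta> s \<omega>) \<partial>lborel \<partial>M)"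
    unfolding N[OF assms] by (subst nn_integral_snd[symmetric]) (simp_all add: case_prod_beta)
  thus "(\<integral>\<^sup>+y. k y \<partial>potential_measure M \<xi>)
           = (\<integral>\<^sup>+\<omega>. (\<integral>\<^sup>+s\<in>{0..}. k (right_limit (shifted_path 0 \<omega>) s) \<partial>lborel) \<partial>M)"
    unfolding U \<eta>_def by (simp add: mult.commute)
qed

end

section \<open>Integrability over superlevel sets\<close>

text \<open>
  The set of times \<open>s\<close> at which the tail is at most \<open>K\<close> is upward closed. Up to its infimum, it is
  exhausted by the half-lines starting at its own points, and the mass of each of these is a tail that
  is at most \<open>K\<close>.
\<close>

lemma nn_integral_where_tail_le:
  fixes \<phi> :: "real \<Rightarrow> ennreal"
  assumes [measurable]: "\<phi> \<in> borel_measurable borel"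
  shows "(\<integral>\<^sup>+s. \<phi> s * indicator {s. (\<integral>\<^sup>+u\<in>{s..}. \<phi> u \<partial>lborel) \<le> K} s \<partial>lborel) \<le> K"
proof -
  define T where "T s = (\<integral>\<^sup>+u\<in>{s..}. \<phi> u \<partial>lborel)" for s
  define S where "S = {s. T s \<le> K}"
  let ?N = "density lborel \<phi>"
  have T: "T s = emeasure ?N {s..}" for s
    unfolding T_def by (subst emeasure_density) auto
  have up: "s' \<in> S" if "s \<in> S" "s \<le> s'" for s s'
  proof -
    have "T s' \<le> T s" unfolding T using that by (intro emeasure_mono) auto
    thus ?thesis using that by (simp add: S_def)
  qed
  have countable_exhaustion: "\<exists>s::nat \<Rightarrow> real. range s \<subseteq> S \<and> decseq s \<and> (AE r in lborel. r \<in> S \<longrightarrow> r \<in> (\<Union>n. {s n..}))"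
    if ne: "S \<noteq> {}"
  proof (cases "bdd_below S")
    case True
    define i where "i = Inf S"
    have "i + 1 / real (Suc n) \<in> S" for n
    proof -
      have "\<exists>r\<in>S. r < i + 1 / real (Suc n)"
        using cInf_less_iff[OF ne True, of "i + 1 / real (Suc n)"] by (simp add: i_def)
      thus ?thesis using up less_imp_le by blast
    qed
    moreover have "decseq (\<lambda>n. i + 1 / real (Suc n))"
      by (auto simp: decseq_def intro!: divide_left_mono)
    moreover have "AE r in lborel. r \<in> S \<longrightarrow> r \<in> (\<Union>n. {i + 1 / real (Suc n)..})"
    proof -
      have "AE r in lborel. r \<noteq> i" by (rule AE_lborel_singleton)
      thus ?thesis
      proof eventually_elim
        case (elim r)
        show ?case
        proof
          assume "r \<in> S"
          hence "i \<le> r" unfolding i_def by (rule cInf_lower[OF _ True])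
          hence "0 < r - i" using elim by simp
          then obtain n where "inverse (real (Suc n)) < r - i" using reals_Archimedean by blast
          hence "r \<in> {i + 1 / real (Suc n)..}" by (simp add: inverse_eq_divide)
          thus "r \<in> (\<Union>n. {i + 1 / real (Suc n)..})" by blast
        qed
      qed
    qed
    ultimately show ?thesis by (intro exI[of _ "\<lambda>n. i + 1 / real (Suc n)"]) auto
  next
    case False
    have "- real n \<in> S" for n
    proof -
      obtain r where "r \<in> S" "r < - real n" using False unfolding bdd_below_def by (meson not_le)
      thus ?thesis using up by (meson less_imp_le)
    qed
    moreover have "decseq (\<lambda>n. - real n)" by (auto simp: decseq_def)
    moreover have "r \<in> (\<Union>n. {- real n..})" for r
    proof -
      obtain n where "- r \<le> real n" using real_arch_simple by blast
      thus ?thesis by (auto intro!: exI[of _ n])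
    qed
    ultimately show ?thesis by (intro exI[of _ "\<lambda>n. - real n"]) auto
  qed
  have "(\<integral>\<^sup>+s. \<phi> s * indicator S s \<partial>lborel) \<le> K"
  proof (cases "S = {}")
    case False
    then obtain s where s: "range s \<subseteq> S" "decseq s" "AE r in lborel. r \<in> S \<longrightarrow> r \<in> (\<Union>n. {s n..})"
      using countable_exhaustion by blast
    have "(\<integral>\<^sup>+s. \<phi> s * indicator S s \<partial>lborel) \<le> (\<integral>\<^sup>+r. \<phi> r * indicator (\<Union>n. {s n..}) r \<partial>lborel)"
      by (intro nn_integral_mono_AE, use s(3) in eventually_elim) (auto simp: indicator_def)
    also have "\<dots> = emeasure ?N (\<Union>n. {s n..})"
      by (subst emeasure_density) auto
    also have "\<dots> = (SUP n. emeasure ?N {s n..})"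
      using s(2) by (intro SUP_emeasure_incseq[symmetric]) (auto simp: incseq_def decseq_def intro: order_trans)
    also have "\<dots> \<le> K"
      using s(1) unfolding S_def T by (intro SUP_least) auto
    finally show ?thesis .
  qed simp
  thus ?thesis by (simp add: S_def T_def)
qed

context levy_process
begin

text \<open>
  Conditioning on the position at time \<open>s\<close> turns the factor \<open>perpetual_prob g {..1} (x + \<xi> s)\<close> into the
  event that the integral over \<open>[s, \<infinity>)\<close> is at most 1. The claim then holds path by path, by
  \<open>nn_integral_where_tail_le\<close>.
\<close>

lemma nn_integral_perpetual_prob_le:
  assumes [measurable]: "g \<in> borel_measurable borel"
  shows "(\<integral>\<^sup>+y. ennreal (g (x + y)) * ennreal (perpetual_prob g {..1} (x + y)) \<partial>potential_measure M \<xi>) \<le> 1"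
proof -
  interpret pair_sigma_finite lborel M ..
  let ?\<eta> = "\<lambda>s \<omega>. right_limit (shifted_path 0 \<omega>) s"
  define \<phi> where "\<phi> \<omega> s = ennreal (g (x + ?\<eta> s \<omega>)) * indicator {0..} s" for s \<omega>
  define T where "T \<omega> s = (\<integral>\<^sup>+u\<in>{s..}. \<phi> \<omega> u \<partial>lborel)" for \<omega> s
  have [measurable]: "(\<lambda>z. \<phi> (snd z) (fst z)) \<in> borel_measurable (lborel \<Otimes>\<^sub>M M)"
    unfolding \<phi>_def by measurable
  have [measurable]: "(\<lambda>z. T (snd z) (fst z)) \<in> borel_measurable (lborel \<Otimes>\<^sub>M M)"
  proof -
    have "T = (\<lambda>\<omega> s. \<integral>\<^sup>+u. \<phi> \<omega> u * (if s \<le> u then 1 else 0) \<partial>lborel)"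
      unfolding T_def by (intro ext nn_integral_cong) (simp add: indicator_def)
    thus ?thesis unfolding \<phi>_def by simp
  qed
  have T: "T \<omega> s = tail_integral g s x (shifted_path 0 \<omega>)" if "0 \<le> s" for \<omega> s
    unfolding T_def \<phi>_def tail_integral_def using that
    by (intro nn_integral_cong) (auto simp: indicator_def)
  have "(\<integral>\<^sup>+y. ennreal (g (x + y)) * ennreal (perpetual_prob g {..1} (x + y)) \<partial>potential_measure M \<xi>)
      = (\<integral>\<^sup>+s\<in>{0..}. (\<integral>\<^sup>+\<omega>. ennreal (g (x + \<xi> s \<omega>)) * ennreal (perpetual_prob g {..1} (x + \<xi> s \<omega>)) \<partial>M) \<partial>lborel)"
    by (rule nn_integral_potential_measure) measurable
  also have "\<dots> = (\<integral>\<^sup>+s. (\<integral>\<^sup>+\<omega>. \<phi> \<omega> s * indicator {..1} (T \<omega> s) \<partial>M) \<partial>lborel)"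
  proof (intro nn_integral_cong)
    fix s :: real
    show "(\<integral>\<^sup>+\<omega>. ennreal (g (x + \<xi> s \<omega>)) * ennreal (perpetual_prob g {..1} (x + \<xi> s \<omega>)) \<partial>M) * indicator {0..} s
      = (\<integral>\<^sup>+\<omega>. \<phi> \<omega> s * indicator {..1} (T \<omega> s) \<partial>M)"
    proof (cases "0 \<le> s")
      case True
      have [measurable]: "(\<lambda>v. v s) \<in> borel_measurable (PiM {s} (\<lambda>_. borel))"
        by (rule measurable_component_singleton) simp
      have "(\<integral>\<^sup>+\<omega>. ennreal (g (x + \<xi> s \<omega>)) * ennreal (perpetual_prob g {..1} (x + \<xi> s \<omega>)) \<partial>M)
          = (\<integral>\<^sup>+\<omega>. ennreal (g (x + \<xi> s \<omega>)) * indicator {..1} (tail_integral g s x (shifted_path 0 \<omega>)) \<partial>M)"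
        using markov_perpetual_prob[OF True, of "{s}" "\<lambda>v. ennreal (g (x + v s))" g "{..1}" x] True
        by simp
      also have "\<dots> = (\<integral>\<^sup>+\<omega>. \<phi> \<omega> s * indicator {..1} (T \<omega> s) \<partial>M)"
        by (intro nn_integral_cong_AE, use AE_right_limit_path in eventually_elim)
           (use True in \<open>auto simp: T \<phi>_def\<close>)
      finally show ?thesis using True by simp
    qed (simp add: \<phi>_def)
  qed
  also have "\<dots> = (\<integral>\<^sup>+\<omega>. (\<integral>\<^sup>+s. \<phi> \<omega> s * indicator {..1} (T \<omega> s) \<partial>lborel) \<partial>M)"
    by (rule Fubini'[symmetric]) (simp add: case_prod_beta)
  also have "\<dots> \<le> (\<integral>\<^sup>+\<omega>. 1 \<partial>M)"
  proof (intro nn_integral_mono)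
    fix \<omega> assume [measurable]: "\<omega> \<in> space M"
    have [measurable]: "\<phi> \<omega> \<in> borel_measurable borel" unfolding \<phi>_def by measurable
    have "(\<integral>\<^sup>+s. \<phi> \<omega> s * indicator {s. T \<omega> s \<le> 1} s \<partial>lborel) \<le> 1"
      unfolding T_def by (rule nn_integral_where_tail_le) measurable
    thus "(\<integral>\<^sup>+s. \<phi> \<omega> s * indicator {..1} (T \<omega> s) \<partial>lborel) \<le> 1"
      by (simp add: indicator_def)
  qed
  also have "\<dots> = 1" by (simp add: emeasure_space_1)
  finally show ?thesis .
qed

text \<open>
  On \<open>E\<close> the weight in \<open>nn_integral_perpetual_prob_le\<close> is at least \<open>\<delta>\<close>, so dropping it costs a factor of
  at most \<open>1/\<delta>\<close>.
\<close>

lemma potential_integral_perpetual_prob_ge: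
  assumes [measurable]: "g \<in> borel_measurable borel" and \<delta>: "0 < \<delta>"
    and E: "\<And>y. y \<in> E \<Longrightarrow> \<delta> \<le> perpetual_prob g {..1} y"
  shows "potential_integral M \<xi> g x E < \<infinity>"
proof -
  have "potential_integral M \<xi> g x E
      \<le> (\<integral>\<^sup>+y. ennreal (1 / \<delta>) * (ennreal (g (x + y)) * ennreal (perpetual_prob g {..1} (x + y))) \<partial>potential_measure M \<xi>)"
    unfolding potential_integral_def
  proof (intro nn_integral_mono)
    fix y
    show "ennreal (g (x + y)) * indicator {y. x + y \<in> E} y
      \<le> ennreal (1 / \<delta>) * (ennreal (g (x + y)) * ennreal (perpetual_prob g {..1} (x + y)))"
    proof (cases "x + y \<in> E")
      case True
      have "1 \<le> 1 / \<delta> * perpetual_prob g {..1} (x + y)"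
        using E[OF True] \<delta> by (simp add: field_simps)
      hence "(1::ennreal) \<le> ennreal (1 / \<delta> * perpetual_prob g {..1} (x + y))"
        by (metis ennreal_1 ennreal_leI)
      hence "(1::ennreal) \<le> ennreal (1 / \<delta>) * ennreal (perpetual_prob g {..1} (x + y))"
        using \<delta> by (subst (asm) ennreal_mult') auto
      from mult_left_mono[OF this, of "ennreal (g (x + y))"]
      show ?thesis using True by (simp add: ac_simps)
    qed simp
  qed
  also have "\<dots> = ennreal (1 / \<delta>) * (\<integral>\<^sup>+y. ennreal (g (x + y)) * ennreal (perpetual_prob g {..1} (x + y)) \<partial>potential_measure M \<xi>)"
    by (rule nn_integral_cmult) measurable
  also have "\<dots> \<le> ennreal (1 / \<delta>) * 1"
    by (intro mult_left_mono nn_integral_perpetual_prob_le) simp_all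
  also have "\<dots> < \<infinity>" by simp
  finally show ?thesis .
qed

end

section \<open>Integrability over a set that is eventually not left\<close>

text \<open>
  One-sided limits make the path bounded near each time, and compactness, in the form of a bisection
  argument, makes the bound uniform.
\<close>

lemma cadlag_bounded_on_compact:
  fixes p :: "real \<Rightarrow> real"
  assumes right: "\<And>s. 0 \<le> s \<Longrightarrow> continuous (at_right s) p"
    and left: "\<And>s. 0 < s \<Longrightarrow> \<exists>l. (p \<longlongrightarrow> l) (at_left s)"
    and T: "0 \<le> T"
  shows "bounded (p ` {0..T})"
proof -
  have loc: "\<exists>B. eventually (\<lambda>r. \<bar>p r\<bar> \<le> B) F" if "(p \<longlongrightarrow> l) F" for l F
  proof (rule exI[of _ "\<bar>l\<bar> + 1"])
    have "eventually (\<lambda>r. \<bar>p r - l\<bar> < 1) F"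
      using tendstoD[OF that, of 1] by (simp add: dist_real_def)
    thus "eventually (\<lambda>r. \<bar>p r\<bar> \<le> \<bar>l\<bar> + 1) F" by eventually_elim linarith
  qed
  define P where "P a b \<longleftrightarrow> (\<exists>B. \<forall>r. 0 \<le> r \<and> r \<in> {a..b} \<longrightarrow> \<bar>p r\<bar> \<le> B)" for a b
  have "P 0 T"
    using T
  proof (induct rule: Bolzano)
    case (trans a b c)
    then obtain B1 B2 where "\<forall>r. 0 \<le> r \<and> r \<in> {a..b} \<longrightarrow> \<bar>p r\<bar> \<le> B1"
      "\<forall>r. 0 \<le> r \<and> r \<in> {b..c} \<longrightarrow> \<bar>p r\<bar> \<le> B2"
      unfolding P_def by blast
    thus ?case unfolding P_def by (intro exI[of _ "max B1 B2"]) (auto simp: le_max_iff_disj, metis linear)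
  next
    case (local s)
    have "\<exists>B. eventually (\<lambda>r. \<bar>p r\<bar> \<le> B) (at_right s)"
      using right[OF local(1)] by (intro loc) (simp add: continuous_within)
    then obtain B1 d1 where d1: "s < d1" "\<And>r. s < r \<Longrightarrow> r < d1 \<Longrightarrow> \<bar>p r\<bar> \<le> B1"
      unfolding eventually_at_right_field by blast
    obtain B2 d2 where d2: "d2 < s" "\<And>r. 0 \<le> r \<Longrightarrow> d2 < r \<Longrightarrow> r < s \<Longrightarrow> \<bar>p r\<bar> \<le> B2"
    proof (cases "s = 0")
      case True
      thus ?thesis by (intro that[of "-1" 0]) auto
    next
      case False
      hence "\<exists>B. eventually (\<lambda>r. \<bar>p r\<bar> \<le> B) (at_left s)"
        using left[of s] local(1) loc by auto
      then obtain B d where "d < s" "\<And>r. d < r \<Longrightarrow> r < s \<Longrightarrow> \<bar>p r\<bar> \<le> B"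
        unfolding eventually_at_left_field by blast
      thus ?thesis by (intro that[of d B]) auto
    qed
    show ?case
    proof (intro exI[of _ "min (d1 - s) (s - d2)"] conjI allI impI)
      fix a b assume ab: "a \<le> s \<and> s \<le> b \<and> b - a < min (d1 - s) (s - d2)"
      have "\<bar>p r\<bar> \<le> max (max B1 B2) \<bar>p s\<bar>" if "0 \<le> r" "r \<in> {a..b}" for r
      proof -
        consider "r = s" | "s < r" | "r < s" by linarith
        thus ?thesis
          using d1(2)[of r] d2(2)[of r] that ab by cases (auto simp: le_max_iff_disj)
      qed
      thus "P a b" unfolding P_def by blast
    qed (use d1(1) d2(1) in auto)
  qed
  thus ?thesis by (fastforce simp: bounded_iff P_def)
qed

lemma locally_bounded_on_interval:
  assumes "locally_bounded f" shows "bounded (f ` {a..b})"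
proof -
  have "\<forall>y. \<exists>V. open V \<and> y \<in> V \<and> bounded (f ` V)" using assms by (simp add: locally_bounded_def)
  then obtain V where V: "\<And>y. open (V y)" "\<And>y. y \<in> V y" "\<And>y. bounded (f ` V y)" by metis
  obtain C where C: "finite C" "C \<subseteq> {a..b}" "{a..b} \<subseteq> (\<Union>y\<in>C. V y)"
    by (rule compactE_image[OF compact_Icc[of a b], of "{a..b}" V]) (use V in auto)
  have "bounded (\<Union>y\<in>C. f ` V y)" using C(1) V(3) by (intro bounded_UN) auto
  thus ?thesis by (rule bounded_subset) (use C(3) in blast)
qed

lemma continuous_imp_locally_bounded:
  fixes f :: "real \<Rightarrow> real"
  assumes "continuous_on UNIV f" shows "locally_bounded f"
  unfolding locally_bounded_def
proof
  fix y
  have "bounded (f ` cball y 1)"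
    by (intro compact_imp_bounded compact_continuous_image continuous_on_subset[OF assms]) auto
  hence "bounded (f ` ball y 1)" by (rule bounded_subset) auto
  thus "\<exists>V. open V \<and> y \<in> V \<and> bounded (f ` V)" by (intro exI[of _ "ball y 1"]) auto
qed

context levy_process
begin

lemma AE_finite_on_compact_time:
  assumes "f \<in> borel_measurable borel" "locally_bounded f"
  shows "AE \<omega> in M. \<forall>T\<ge>0.
    (\<integral>\<^sup>+s\<in>{0..T}. ennreal (f (x + right_limit (shifted_path 0 \<omega>) s)) \<partial>lborel) < \<infinity>"
  using cadlag_paths AE_right_limit_path
proof eventually_elim
  case (elim \<omega>)
  show ?case
  proof (intro allI impI)
    fix T :: real assume T: "0 \<le> T"
    have "bounded ((\<lambda>s. \<xi> s \<omega>) ` {0..T})"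
      using elim(1) by (intro cadlag_bounded_on_compact T) auto
    then obtain R where R: "\<And>s. 0 \<le> s \<Longrightarrow> s \<le> T \<Longrightarrow> \<bar>\<xi> s \<omega>\<bar> \<le> R"
      by (force simp: bounded_iff)
    have "bounded (f ` {x - R..x + R})" by (rule locally_bounded_on_interval) fact
    then obtain C where C: "\<And>y. x - R \<le> y \<Longrightarrow> y \<le> x + R \<Longrightarrow> \<bar>f y\<bar> \<le> C"
      by (force simp: bounded_iff)
    have "(\<integral>\<^sup>+s\<in>{0..T}. ennreal (f (x + right_limit (shifted_path 0 \<omega>) s)) \<partial>lborel)
        \<le> (\<integral>\<^sup>+s\<in>{0..T}. ennreal C \<partial>lborel)"
    proof (intro nn_integral_mono)
      fix s
      show "ennreal (f (x + right_limit (shifted_path 0 \<omega>) s)) * indicator {0..T} s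
        \<le> ennreal C * indicator {0..T} s"
      proof (cases "s \<in> {0..T}")
        case True
        have "f (x + \<xi> s \<omega>) \<le> C"
          using C[of "x + \<xi> s \<omega>"] R[of s] True by force
        thus ?thesis using True elim(2) by (simp add: ennreal_leI)
      qed simp
    qed
    also have "\<dots> = ennreal C * ennreal T"
      using T by (subst nn_integral_cmult) auto
    also have "\<dots> < \<infinity>" by (simp add: ennreal_mult_less_top)
    finally show "(\<integral>\<^sup>+s\<in>{0..T}. ennreal (f (x + right_limit (shifted_path 0 \<omega>) s)) \<partial>lborel) < \<infinity>" .
  qed
qed

text \<open>
  The potential integral over \<open>E\<close> is the expected time integral of \<open>f\<close> restricted to \<open>E\<close>. Nothing is
  lost by the restriction from some time \<open>\<tau>\<close> on, and the integral up to \<open>\<tau>\<close> is finite by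
  \<open>AE_finite_on_compact_time\<close>.
\<close>

lemma AE_perpetual_integral_finite:
  assumes f[measurable]: "f \<in> borel_measurable borel" "locally_bounded f"
    and E[measurable]: "E \<in> sets borel"
    and trans: "transient_set M \<xi> x (- E)" and fin: "potential_integral M \<xi> f x E < \<infinity>"
  shows "AE \<omega> in M. perpetual_integral \<xi> f x \<omega> < \<infinity>"
proof -
  let ?\<eta> = "\<lambda>s \<omega>. right_limit (shifted_path 0 \<omega>) s"
  let ?I = "\<lambda>\<omega>. \<integral>\<^sup>+s\<in>{0..}. ennreal (f (x + ?\<eta> s \<omega>)) * indicator {y. x + y \<in> E} (?\<eta> s \<omega>) \<partial>lborel"
  have "potential_integral M \<xi> f x E = (\<integral>\<^sup>+\<omega>. ?I \<omega> \<partial>M)"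
    unfolding potential_integral_def by (rule nn_integral_potential_measure) measurable
  hence "AE \<omega> in M. ?I \<omega> \<noteq> \<infinity>"
    using fin by (intro nn_integral_noteq_infinite) (auto simp: less_top)
  with trans[unfolded transient_set_def] AE_right_limit_path
    AE_finite_on_compact_time[OF f, of x] AE_perpetual_integral_eq[of f x]
  show ?thesis
  proof eventually_elim
    case (elim \<omega>)
    from elim(1) obtain \<tau> where \<tau>: "0 \<le> \<tau>" "\<And>s. s \<ge> \<tau> \<Longrightarrow> x + \<xi> s \<omega> \<in> E" by auto
    let ?h = "\<lambda>s. ennreal (f (x + ?\<eta> s \<omega>))"
    have [measurable]: "(\<lambda>s. indicator {y. x + y \<in> E} (?\<eta> s \<omega>) :: ennreal) \<in> borel_measurable lborel"
      by (rule measurable_compose[of "\<lambda>s. ?\<eta> s \<omega>" _ borel]) measurable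
    have "perpetual_integral \<xi> f x \<omega> = (\<integral>\<^sup>+s. ?h s * indicator {0..} s \<partial>lborel)"
      using elim(4) by (simp add: tail_integral_def)
    also have "\<dots> \<le> (\<integral>\<^sup>+s. ?h s * indicator {0..\<tau>} s
        + ?h s * indicator {y. x + y \<in> E} (?\<eta> s \<omega>) * indicator {0..} s \<partial>lborel)"
      using elim(2) \<tau> by (intro nn_integral_mono) (auto simp: indicator_def)
    also have "\<dots> = (\<integral>\<^sup>+s\<in>{0..\<tau>}. ?h s \<partial>lborel) + ?I \<omega>"
      by (rule nn_integral_add) measurable
    also have "\<dots> < \<infinity>" using elim(3,5) \<tau>(1) by (auto simp: less_top)
    finally show ?case .
  qed
qed

end

section \<open>Ultimately non-increasing functions\<close>

context levy_process
begin

text \<open>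
  Freezing \<open>f\<close> to the left of \<open>l\<close> gives a function \<open>g\<close> that is non-increasing everywhere and does
  not affect tails of the integral, as the process tends to infinity. Starting further to the right
  makes the integral of \<open>g\<close> smaller, so superlevel sets of \<open>perpetual_prob g {..1}\<close> extend to the
  right, and the process eventually stays in any half-line \<open>[b, \<infinity>)\<close>.
\<close>

lemma transient_complement_exists_nonincreasing:
  assumes f[measurable]: "f \<in> borel_measurable borel" and anti: "antimono_on {l..} f"
    and infty: "AE \<omega> in M. filterlim (\<lambda>s. \<xi> s \<omega>) at_top at_top"
    and not_inf: "\<not> (AE \<omega> in M. \<not> perpetual_integral \<xi> f x \<omega> < \<infinity>)"
  shows "\<exists>E\<in>sets borel. transient_set M \<xi> x (- E) \<and> potential_integral M \<xi> f x E < \<infinity>"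
proof -
  define g where "g y = f (max l y)" for y
  have [measurable]: "g \<in> borel_measurable borel" unfolding g_def by measurable
  have g_anti: "g z \<le> g y" if "y \<le> z" for y z
    using monotone_onD[OF anti, of "max l y" "max l z"] that by (auto simp: g_def)
  let ?P = "perpetual_prob g {..1}"
  have P_mono: "?P y \<le> ?P z" if "y \<le> z" for y z
    unfolding perpetual_prob_def
  proof (rule finite_measure_mono)
    have "tail_integral g 0 z p \<le> tail_integral g 0 y p" for p
      unfolding tail_integral_def using that
      by (intro nn_integral_mono mult_right_mono ennreal_leI g_anti) auto
    thus "{\<omega>\<in>space M. tail_integral g 0 y (shifted_path 0 \<omega>) \<in> {..1}}
        \<subseteq> {\<omega>\<in>space M. tail_integral g 0 z (shifted_path 0 \<omega>) \<in> {..1}}"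
      using order_trans by auto
  qed measurable
  (* Otherwise every tail of the integral of g would almost surely exceed 1. *)
  have "\<exists>y. 0 < ?P y"
  proof (rule ccontr)
    assume "\<nexists>y. 0 < ?P y"
    hence zero: "?P y = 0" for y using perpetual_prob_bounds(1)[of g "{..1}" y] by (auto simp: order_less_le)
    have "AE \<omega> in M. \<forall>n. \<not> tail_integral g (real n) x (shifted_path 0 \<omega>) \<le> 1"
      unfolding AE_all_countable
    proof
      fix n
      have "(\<integral>\<^sup>+\<omega>. indicator {..1} (tail_integral g (real n) x (shifted_path 0 \<omega>)) \<partial>M) = 0"
        using markov_perpetual_prob[of "real n" "{real n}" "\<lambda>_. 1" g "{..1}" x] by (simp add: zero)
      hence "AE \<omega> in M. indicator {..1} (tail_integral g (real n) x (shifted_path 0 \<omega>)) = (0::ennreal)"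
        by (subst (asm) nn_integral_0_iff_AE) auto
      thus "AE \<omega> in M. \<not> tail_integral g (real n) x (shifted_path 0 \<omega>) \<le> 1"
        by eventually_elim (auto simp: indicator_def split: if_splits)
    qed
    with infty AE_right_limit_path AE_perpetual_integral_eq[of f x]
    have "AE \<omega> in M. \<not> perpetual_integral \<xi> f x \<omega> < \<infinity>"
    proof eventually_elim
      case (elim \<omega>)
      show ?case
      proof
        assume "perpetual_integral \<xi> f x \<omega> < \<infinity>"
        hence "(\<lambda>n. tail_integral f (real n) x (shifted_path 0 \<omega>)) \<longlonglongrightarrow> 0"
          using elim(3) by (intro tail_integral_tendsto_zero) simp_all
        hence "eventually (\<lambda>n. tail_integral f (real n) x (shifted_path 0 \<omega>) < 1) sequentially"
          by (rule order_tendstoD) simp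
        moreover have "eventually (\<lambda>n. tail_integral f (real n) x (shifted_path 0 \<omega>)
            = tail_integral g (real n) x (shifted_path 0 \<omega>)) sequentially"
        proof -
          have "eventually (\<lambda>s. l - x \<le> \<xi> s \<omega>) at_top"
            using elim(1) by (simp add: filterlim_at_top)
          then obtain S where S: "\<And>s. s \<ge> S \<Longrightarrow> l - x \<le> \<xi> s \<omega>" by (auto simp: eventually_at_top_linorder)
          obtain m where m: "S \<le> real m" using real_arch_simple by blast
          show ?thesis
            unfolding eventually_sequentially
          proof (intro exI[of _ m] allI impI)
            fix n assume "m \<le> n"
            hence "max l (x + \<xi> s \<omega>) = x + \<xi> s \<omega>" if "real n \<le> s" for s
              using that m S[of s] by linarith
            thus "tail_integral f (real n) x (shifted_path 0 \<omega>) = tail_integral g (real n) x (shifted_path 0 \<omega>)"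
              unfolding tail_integral_def g_def using elim(2)
              by (intro nn_integral_cong) (auto simp: indicator_def)
          qed
        qed
        ultimately have "eventually (\<lambda>n. tail_integral g (real n) x (shifted_path 0 \<omega>) \<le> 1) sequentially"
          by eventually_elim simp
        thus False using elim(4) by (auto simp: eventually_sequentially)
      qed
    qed
    with not_inf show False ..
  qed
  then obtain y where y: "0 < ?P y" ..
  let ?E = "{max l y..}"
  have "transient_set M \<xi> x (- ?E)"
    unfolding transient_set_def using infty
  proof eventually_elim
    case (elim \<omega>)
    hence "eventually (\<lambda>s. max l y - x \<le> \<xi> s \<omega>) at_top" by (simp add: filterlim_at_top)
    then obtain S where "\<And>s. s \<ge> S \<Longrightarrow> max l y - x \<le> \<xi> s \<omega>" by (auto simp: eventually_at_top_linorder)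
    thus ?case by (intro exI[of _ "max 0 S"]) (auto simp: algebra_simps)
  qed
  moreover have "potential_integral M \<xi> f x ?E = potential_integral M \<xi> g x ?E"
    unfolding potential_integral_def g_def
    by (intro nn_integral_cong) (auto simp: indicator_def max_def)
  moreover have "potential_integral M \<xi> g x ?E < \<infinity>"
    by (rule potential_integral_perpetual_prob_ge[OF _ y]) (auto intro: P_mono)
  ultimately show ?thesis by (intro bexI[of _ ?E]) auto
qed

end

section \<open>Harmonicity of the probability of a finite perpetual integral\<close>

text \<open>
  The analytic core of the Choquet--Deny theorem. With \<open>a\<close>, \<open>b\<close> independent of law \<open>N\<close>, the
  variables \<open>A = h(x + a)\<close> and \<open>B = h(x + b)\<close> have the same joint law with \<open>C = h(x + a + b)\<close>, because
  the sum is symmetric. Harmonicity makes \<open>A\<close> and \<open>B\<close> conditional expectations of \<open>C\<close>, so both are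
  at mean square distance \<open>V' - V\<close> from \<open>C\<close>; they are independent, so they are at mean square
  distance \<open>2 (V - c\<^sup>2)\<close> from each other.
\<close>

lemma choquet_deny_step:
  fixes h :: "real \<Rightarrow> real"
  assumes N: "prob_space N" and sets_N[measurable_cong]: "sets N = sets borel"
    and h[measurable]: "h \<in> borel_measurable borel" and bnd: "\<And>y. 0 \<le> h y" "\<And>y. h y \<le> 1"
    and harmonic: "\<And>a. (\<integral>b. h (x + a + b) \<partial>N) = h (x + a)"
  defines "c \<equiv> \<integral>a. h (x + a) \<partial>N"
    and "V \<equiv> \<integral>a. (h (x + a))\<^sup>2 \<partial>N"
    and "V' \<equiv> \<integral>z. (h (x + (fst z + snd z)))\<^sup>2 \<partial>(N \<Otimes>\<^sub>M N)"
  shows "V - c\<^sup>2 \<le> 2 * (V' - V)"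
proof -
  interpret N: prob_space N by fact
  interpret P: pair_prob_space N N ..
  let ?P = "N \<Otimes>\<^sub>M N"
  define A where "A z = h (x + fst z)" for z :: "real \<times> real"
  define B where "B z = h (x + snd z)" for z :: "real \<times> real"
  define C where "C z = h (x + (fst z + snd z))" for z :: "real \<times> real"
  have meas[measurable]: "A \<in> borel_measurable ?P" "B \<in> borel_measurable ?P" "C \<in> borel_measurable ?P"
    unfolding A_def B_def C_def by measurable
  have prod_bnd: "\<bar>h y * h y'\<bar> \<le> 1" "h y * h y' \<le> 1" for y y'
    using mult_mono[of "h y" 1 "h y'" 1] bnd by (simp_all add: abs_mult)
  have int: "integrable ?P (\<lambda>z. F z * G z)"
    if "F \<in> {A, B, C}" "G \<in> {A, B, C}" for F G
    using that by (intro P.P.integrable_const_bound[where B = 1])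
      (auto simp: A_def B_def C_def intro!: AE_I2 prod_bnd)
  have AA: "(\<integral>z. A z * A z \<partial>?P) = V"
    using P.integral_fst'[OF int[of A A]] by (simp add: A_def V_def power2_eq_square N.prob_space)
  have BB: "(\<integral>z. B z * B z \<partial>?P) = V"
    using P.integral_fst'[OF int[of B B]] by (simp add: B_def V_def power2_eq_square N.prob_space)
  have CC: "(\<integral>z. C z * C z \<partial>?P) = V'"
    by (simp add: C_def V'_def power2_eq_square)
  have AB: "(\<integral>z. A z * B z \<partial>?P) = c\<^sup>2"
    using P.integral_fst'[OF int[of A B]] by (simp add: A_def B_def c_def power2_eq_square N.prob_space)
  have AC: "(\<integral>z. A z * C z \<partial>?P) = V"
    using P.integral_fst'[OF int[of A C]] harmonic
    by (simp add: A_def C_def V_def power2_eq_square add.assoc)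
  have BC: "(\<integral>z. B z * C z \<partial>?P) = V"
  proof -
    have "(\<integral>z. B z * C z \<partial>?P) = (\<integral>b. \<integral>a. B (a, b) * C (a, b) \<partial>N \<partial>N)"
      using P.integral_snd[of "\<lambda>a b. B (a, b) * C (a, b)"] int[of B C] by (simp add: case_prod_beta')
    also have "\<dots> = V"
    proof -
      have "(\<integral>a. h (x + (a + b)) \<partial>N) = h (x + b)" for b
        using harmonic[of b] by (simp add: ac_simps)
      thus ?thesis by (simp add: B_def C_def V_def power2_eq_square)
    qed
    finally show ?thesis .
  qed
  (* Compare A with B through C. *)
  have "(\<integral>z. (A z - B z)\<^sup>2 \<partial>?P) \<le> (\<integral>z. 2 * (A z - C z)\<^sup>2 + 2 * (B z - C z)\<^sup>2 \<partial>?P)"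
  proof (rule integral_mono)
    have exp: "(F z - G z)\<^sup>2 = F z * F z - 2 * (F z * G z) + G z * G z" for F G :: "real \<times> real \<Rightarrow> real" and z
      by (simp add: power2_eq_square algebra_simps)
    show "integrable ?P (\<lambda>z. (A z - B z)\<^sup>2)"
      unfolding exp using int by auto
    show "integrable ?P (\<lambda>z. 2 * (A z - C z)\<^sup>2 + 2 * (B z - C z)\<^sup>2)"
      unfolding exp using int by auto
    show "(A z - B z)\<^sup>2 \<le> 2 * (A z - C z)\<^sup>2 + 2 * (B z - C z)\<^sup>2" for z
      using zero_le_power2[of "(A z - C z) + (B z - C z)"] by (simp add: power2_eq_square algebra_simps)
  qed
  moreover have "(\<integral>z. (A z - B z)\<^sup>2 \<partial>?P) = V - 2 * c\<^sup>2 + V"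
  proof -
    have "(\<integral>z. (A z - B z)\<^sup>2 \<partial>?P) = (\<integral>z. A z * A z - 2 * (A z * B z) + B z * B z \<partial>?P)"
      by (simp add: power2_eq_square algebra_simps)
    also have "\<dots> = V - 2 * c\<^sup>2 + V" using int by (simp add: AA AB BB)
    finally show ?thesis .
  qed
  moreover have "(\<integral>z. 2 * (A z - C z)\<^sup>2 + 2 * (B z - C z)\<^sup>2 \<partial>?P) = 4 * (V' - V)"
  proof -
    have "(\<integral>z. 2 * (A z - C z)\<^sup>2 + 2 * (B z - C z)\<^sup>2 \<partial>?P)
      = (\<integral>z. 2 * (A z * A z) - 4 * (A z * C z) + 2 * (C z * C z)
          + (2 * (B z * B z) - 4 * (B z * C z) + 2 * (C z * C z)) \<partial>?P)"
      by (intro Bochner_Integration.integral_cong) (auto simp: power2_eq_square algebra_simps)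
    also have "\<dots> = 4 * (V' - V)" using int by (simp add: AA AC CC BB BC)
    finally show ?thesis .
  qed
  ultimately show ?thesis by simp
qed

context levy_process
begin

lemma AE_tail_integral_finite_iff:
  assumes f[measurable]: "f \<in> borel_measurable borel" "locally_bounded f"
  shows "AE \<omega> in M. \<forall>t\<ge>0. tail_integral f t x (shifted_path 0 \<omega>) < \<infinity>
    \<longleftrightarrow> tail_integral f 0 x (shifted_path 0 \<omega>) < \<infinity>"
  using AE_finite_on_compact_time[OF f, of x]
proof eventually_elim
  case (elim \<omega>)
  show ?case
  proof (intro allI impI iffI)
    fix t :: real assume t: "0 \<le> t"
    let ?h = "\<lambda>s. ennreal (f (x + right_limit (shifted_path 0 \<omega>) s))"
    {
      assume fin: "tail_integral f t x (shifted_path 0 \<omega>) < \<infinity>"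
      have "tail_integral f 0 x (shifted_path 0 \<omega>)
          \<le> (\<integral>\<^sup>+s. ?h s * indicator {0..t} s + ?h s * indicator {t..} s \<partial>lborel)"
        unfolding tail_integral_def by (intro nn_integral_mono) (auto simp: indicator_def)
      also have "\<dots> = (\<integral>\<^sup>+s\<in>{0..t}. ?h s \<partial>lborel) + tail_integral f t x (shifted_path 0 \<omega>)"
        unfolding tail_integral_def by (rule nn_integral_add) measurable
      also have "\<dots> < \<infinity>" using fin elim t by simp
      finally show "tail_integral f 0 x (shifted_path 0 \<omega>) < \<infinity>" .
    }
    assume "tail_integral f 0 x (shifted_path 0 \<omega>) < \<infinity>"
    with tail_integral_antimono[OF t, of f x] show "tail_integral f t x (shifted_path 0 \<omega>) < \<infinity>"
      by (rule order.strict_trans1)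
  qed
qed

text \<open>
  The integral over a bounded time interval is finite, so whether the perpetual integral is finite is
  decided after time \<open>t\<close>.
\<close>

lemma perpetual_prob_finite_harmonic:
  assumes f[measurable]: "f \<in> borel_measurable borel" "locally_bounded f" and t: "0 \<le> t"
  shows "(\<integral>\<omega>. perpetual_prob f {..<\<infinity>} (y + \<xi> t \<omega>) \<partial>M) = perpetual_prob f {..<\<infinity>} y"
proof -
  have [measurable]: "\<xi> t \<in> borel_measurable M" using t by (rule random_variable_levy)
  let ?H = "perpetual_prob f {..<\<infinity>}"
  have "(\<integral>\<^sup>+\<omega>. ennreal (?H (y + \<xi> t \<omega>)) \<partial>M)
      = (\<integral>\<^sup>+\<omega>. indicator {..<\<infinity>} (tail_integral f t y (shifted_path 0 \<omega>)) \<partial>M)"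
    using markov_perpetual_prob[OF t, of "{t}" "\<lambda>_. 1" f "{..<\<infinity>}" y] t by simp
  also have "\<dots> = (\<integral>\<^sup>+\<omega>. indicator {..<\<infinity>} (tail_integral f 0 y (shifted_path 0 \<omega>)) \<partial>M)"
  proof (rule nn_integral_cong_AE)
    show "AE \<omega> in M. indicator {..<\<infinity>} (tail_integral f t y (shifted_path 0 \<omega>))
        = (indicator {..<\<infinity>} (tail_integral f 0 y (shifted_path 0 \<omega>)) :: ennreal)"
      using AE_tail_integral_finite_iff[OF f, of y]
    proof eventually_elim
      case (elim \<omega>)
      hence "tail_integral f t y (shifted_path 0 \<omega>) < \<infinity> \<longleftrightarrow> tail_integral f 0 y (shifted_path 0 \<omega>) < \<infinity>"
        using t by blast
      thus ?case by (simp only: indicator_def lessThan_iff)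
    qed
  qed
  also have "\<dots> = ennreal (?H y)"
    by (rule ennreal_perpetual_prob[symmetric]) measurable
  finally have "(\<integral>\<^sup>+\<omega>. ennreal (?H (y + \<xi> t \<omega>)) \<partial>M) = ennreal (?H y)" .
  thus ?thesis
    by (subst integral_eq_nn_integral) (auto simp: perpetual_prob_bounds)
qed

lemma distr_double_time:
  assumes t: "0 \<le> t"
  shows "distr M borel (\<xi> (2 * t))
    = distr (distr M borel (\<xi> t) \<Otimes>\<^sub>M distr M borel (\<xi> t)) borel (\<lambda>z. fst z + snd z)"
proof -
  have xi[measurable]: "\<xi> t \<in> borel_measurable M" "\<xi> (2 * t) \<in> borel_measurable M"
    using t by (auto intro: random_variable_levy)
  have [measurable]: "(\<lambda>v. v t) \<in> borel_measurable (PiM {t} (\<lambda>_. borel))"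
      "(\<lambda>v. v t) \<in> borel_measurable path_space"
    using t by (auto intro: measurable_component_singleton)
  let ?N = "distr M borel (\<xi> t)"
  interpret N: prob_space ?N by (rule prob_space_distr) measurable
  show ?thesis
  proof (rule measure_eqI)
    fix A assume "A \<in> sets (distr M borel (\<xi> (2 * t)))"
    hence A[measurable]: "A \<in> sets borel" by simp
    have "emeasure (distr M borel (\<xi> (2 * t))) A = (\<integral>\<^sup>+\<omega>. indicator A (\<xi> (2 * t) \<omega>) \<partial>M)"
      using nn_integral_distr[of "\<xi> (2 * t)" M borel "indicator A"] by simp
    also have "\<dots> = (\<integral>\<^sup>+\<omega>. indicator A ((\<lambda>j\<in>{t}. \<xi> j \<omega>) t + shifted_path t \<omega> t) \<partial>M)"
      using t by (intro nn_integral_cong) (simp add: shifted_path_def)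
    also have "\<dots> = (\<integral>\<^sup>+\<omega>. \<integral>\<^sup>+\<omega>'. indicator A ((\<lambda>j\<in>{t}. \<xi> j \<omega>) t + shifted_path 0 \<omega>' t) \<partial>M \<partial>M)"
      using t by (intro markov_property[of t "{t}" "\<lambda>v p. indicator A (v t + p t)"]) (auto, measurable)
    also have "\<dots> = (\<integral>\<^sup>+\<omega>. \<integral>\<^sup>+\<omega>'. indicator A (\<xi> t \<omega> + \<xi> t \<omega>') \<partial>M \<partial>M)"
    proof (rule nn_integral_cong, rule nn_integral_cong_AE)
      show "AE \<omega>' in M. indicator A ((\<lambda>j\<in>{t}. \<xi> j \<omega>) t + shifted_path 0 \<omega>' t) =
          (indicator A (\<xi> t \<omega> + \<xi> t \<omega>') :: ennreal)" for \<omega>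
        using start_zero by eventually_elim (use t in \<open>simp add: shifted_path_def\<close>)
    qed
    also have "\<dots> = (\<integral>\<^sup>+a. \<integral>\<^sup>+b. indicator A (a + b) \<partial>?N \<partial>?N)"
      by (simp add: nn_integral_distr)
    also have "\<dots> = (\<integral>\<^sup>+z. indicator A (fst z + snd z) \<partial>(?N \<Otimes>\<^sub>M ?N))"
      by (subst N.nn_integral_fst[symmetric]) simp_all
    also have "\<dots> = emeasure (distr (?N \<Otimes>\<^sub>M ?N) borel (\<lambda>z. fst z + snd z)) A"
      using nn_integral_distr[of "\<lambda>z. fst z + snd z" "?N \<Otimes>\<^sub>M ?N" borel "indicator A"] by simp
    finally show "emeasure (distr M borel (\<xi> (2 * t))) A
      = emeasure (distr (?N \<Otimes>\<^sub>M ?N) borel (\<lambda>z. fst z + snd z)) A" .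
  qed simp
qed

text \<open>
  The variance \<open>d\<close> of \<open>H(x + \<xi>\<^sub>t)\<close> must vanish: by \<open>choquet_deny_step\<close>, doubling the time raises
  the second moment of \<open>H(x + \<xi>\<^sub>t)\<close> by at least \<open>d/2\<close>, but second moments stay bounded by 1.
\<close>

lemma AE_perpetual_prob_finite_const:
  assumes f[measurable]: "f \<in> borel_measurable borel" "locally_bounded f" and t: "0 \<le> t"
  shows "AE \<omega> in M. perpetual_prob f {..<\<infinity>} (x + \<xi> t \<omega>) = perpetual_prob f {..<\<infinity>} x"
proof -
  define H where "H = perpetual_prob f {..<\<infinity>}"
  have H[measurable]: "H \<in> borel_measurable borel" unfolding H_def by measurable
  have bnd: "0 \<le> H y" "H y \<le> 1" for y by (simp_all add: H_def perpetual_prob_bounds)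
  define V where "V s = (\<integral>\<omega>. (H (x + \<xi> s \<omega>))\<^sup>2 \<partial>M)" for s
  have harmonic: "(\<integral>\<omega>. H (y + \<xi> s \<omega>) \<partial>M) = H y" if "0 \<le> s" for y s
    unfolding H_def by (rule perpetual_prob_finite_harmonic[OF f that])
  have step: "V s - (H x)\<^sup>2 \<le> 2 * (V (2 * s) - V s)" if s: "0 \<le> s" for s
  proof -
    have [measurable]: "\<xi> s \<in> borel_measurable M" "\<xi> (2 * s) \<in> borel_measurable M"
      using s by (auto intro: random_variable_levy)
    let ?N = "distr M borel (\<xi> s)"
    have "(\<integral>z. (H (x + (fst z + snd z)))\<^sup>2 \<partial>(?N \<Otimes>\<^sub>M ?N))
        = (\<integral>a. (H (x + a))\<^sup>2 \<partial>distr (?N \<Otimes>\<^sub>M ?N) borel (\<lambda>z. fst z + snd z))"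
      by (subst integral_distr) simp_all
    also have "\<dots> = V (2 * s)"
      unfolding distr_double_time[OF s, symmetric] V_def by (subst integral_distr) simp_all
    finally have "(\<integral>z. (H (x + (fst z + snd z)))\<^sup>2 \<partial>(?N \<Otimes>\<^sub>M ?N)) = V (2 * s)" .
    moreover have "(\<integral>a. (H (x + a))\<^sup>2 \<partial>?N) = V s"
      unfolding V_def by (subst integral_distr) simp_all
    moreover have "(\<integral>a. H (y + a) \<partial>?N) = H y" for y
      using harmonic[OF s, of y] by (subst integral_distr) simp_all
    moreover have "prob_space ?N" by (rule prob_space_distr) measurable
    ultimately show ?thesis
      using choquet_deny_step[of ?N H x] bnd by simp
  qed
  have int: "integrable M (\<lambda>\<omega>. H (x + \<xi> t \<omega>))" "integrable M (\<lambda>\<omega>. (H (x + \<xi> t \<omega>))\<^sup>2)"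
  proof -
    have [measurable]: "\<xi> t \<in> borel_measurable M" using t by (rule random_variable_levy)
    show "integrable M (\<lambda>\<omega>. H (x + \<xi> t \<omega>))" "integrable M (\<lambda>\<omega>. (H (x + \<xi> t \<omega>))\<^sup>2)"
      by (rule integrable_const_bound[where B = 1]; simp add: bnd power_le_one)+
  qed
  have sq: "(\<integral>\<omega>. (H (x + \<xi> t \<omega>) - H x)\<^sup>2 \<partial>M) = V t - (H x)\<^sup>2"
  proof -
    have "(\<integral>\<omega>. (H (x + \<xi> t \<omega>) - H x)\<^sup>2 \<partial>M)
        = (\<integral>\<omega>. (H (x + \<xi> t \<omega>))\<^sup>2 - 2 * H x * H (x + \<xi> t \<omega>) + (H x)\<^sup>2 \<partial>M)"
      by (intro Bochner_Integration.integral_cong) (auto simp: power2_eq_square algebra_simps)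
    also have "\<dots> = V t - (H x)\<^sup>2"
      using int harmonic[OF t, of x] by (simp add: V_def prob_space power2_eq_square)
    finally show ?thesis .
  qed
  have V_le: "V s \<le> 1" if "0 \<le> s" for s
  proof -
    have [measurable]: "\<xi> s \<in> borel_measurable M" using that by (rule random_variable_levy)
    have "V s \<le> (\<integral>\<omega>. 1 \<partial>M)"
      unfolding V_def
      by (intro integral_mono integrable_const_bound[where B = 1]) (auto simp: bnd power_le_one)
    thus ?thesis by (simp add: prob_space)
  qed
  define d where "d = V t - (H x)\<^sup>2"
  have "0 \<le> d" unfolding d_def sq[symmetric] by (intro integral_nonneg_AE) simp
  (* The times 2 ^ n * t come from repeated doubling. Each step adds at least d / 2, because the gap
     between the second moment and its lower bound H x ^ 2 never falls below its initial value d. *)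
  have growth: "(H x)\<^sup>2 + (1 + real n / 2) * d \<le> V (2 ^ n * t)" for n
  proof (induction n)
    case (Suc n)
    have "0 \<le> real n * d" using \<open>0 \<le> d\<close> by simp
    moreover have "V (2 ^ n * t) - (H x)\<^sup>2 \<le> 2 * (V (2 ^ Suc n * t) - V (2 ^ n * t))"
      using step[of "2 ^ n * t"] t by (simp add: mult.assoc)
    ultimately show ?case using Suc by (simp add: algebra_simps add_divide_distrib)
  qed (simp add: d_def)
  have "d = 0"
  proof (rule ccontr)
    assume "d \<noteq> 0"
    hence "0 < d" using \<open>0 \<le> d\<close> by simp
    then obtain n where n: "2 < real n * d" using reals_Archimedean3 by blast
    have "V (2 ^ n * t) \<le> 1" using V_le t by simp
    hence "(1 + real n / 2) * d \<le> 1"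
      using growth[of n] zero_le_power2[of "H x"] by linarith
    thus False using n \<open>0 < d\<close> by (simp add: algebra_simps)
  qed
  hence "(\<integral>\<omega>. (H (x + \<xi> t \<omega>) - H x)\<^sup>2 \<partial>M) = 0" by (simp add: sq d_def)
  moreover have "integrable M (\<lambda>\<omega>. (H (x + \<xi> t \<omega>) - H x)\<^sup>2)"
    using int by (auto simp: power2_diff)
  ultimately have "AE \<omega> in M. (H (x + \<xi> t \<omega>) - H x)\<^sup>2 = 0"
    by (subst (asm) integral_nonneg_eq_0_iff_AE) auto
  thus ?thesis by (simp add: H_def)
qed

end

section \<open>Continuous functions\<close>

context levy_process
begin

text \<open>
  A maximal inequality for the adapted process \<open>h(x + \<xi>\<^sub>s)\<close>. On the event \<open>D s\<close> that \<open>s\<close> is the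
  first time in \<open>F\<close> at which \<open>h(x + \<xi>\<^sub>s) < c/2\<close>, the conditional probability of a finite
  remaining integral is \<open>c\<close>, whereas that of a remaining integral at most 1 is below \<open>c/2\<close>. Hence the
  remaining integral is finite but above 1 with conditional probability at least \<open>c/2\<close>, and then so is
  the integral from the earlier time \<open>T\<close> on.
\<close>

lemma perpetual_prob_maximal_inequality:
  fixes x :: real
  assumes f[measurable]: "f \<in> borel_measurable borel" "locally_bounded f"
    and T: "0 \<le> T" and F: "finite F" "F \<subseteq> {T..}"
  defines "c \<equiv> perpetual_prob f {..<\<infinity>} x"
  shows "c / 2 * prob {\<omega>\<in>space M. \<exists>s\<in>F. perpetual_prob f {..1} (x + \<xi> s \<omega>) < c / 2}
    \<le> prob {\<omega>\<in>space M. 1 < tail_integral f T x (shifted_path 0 \<omega>)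
                        \<and> tail_integral f 0 x (shifted_path 0 \<omega>) < \<infinity>}"
    (is "_ * prob ?bad \<le> prob ?G")
proof -
  let ?P = "perpetual_prob f {..1}" and ?tail = "\<lambda>s \<omega>. tail_integral f s x (shifted_path 0 \<omega>)"
  have c: "0 \<le> c" by (simp add: c_def perpetual_prob_bounds)
  have nn: "0 \<le> s" if "s \<in> F" for s using that F T by auto
  have xi[measurable]: "\<xi> s \<in> borel_measurable M" if "s \<in> F" for s
    using nn[OF that] by (rule random_variable_levy)
  define D where "D s = {\<omega>\<in>space M. ?P (x + \<xi> s \<omega>) < c / 2 \<and> (\<forall>r\<in>{r\<in>F. r < s}. \<not> ?P (x + \<xi> r \<omega>) < c / 2)}" for s
  have D[measurable]: "D s \<in> sets M" if [simp]: "s \<in> F" for s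
  proof -
    have [measurable]: "\<xi> s \<in> borel_measurable M" by (rule xi) simp
    have now: "{\<omega>\<in>space M. ?P (x + \<xi> s \<omega>) < c / 2} \<in> sets M" by measurable
    have before: "{\<omega>\<in>space M. \<forall>r\<in>{r\<in>F. r < s}. \<not> ?P (x + \<xi> r \<omega>) < c / 2} \<in> sets M"
      using F(1) xi by (intro sets.sets_Collect_finite_All) auto
    have "D s = {\<omega>\<in>space M. ?P (x + \<xi> s \<omega>) < c / 2}
        \<inter> {\<omega>\<in>space M. \<forall>r\<in>{r\<in>F. r < s}. \<not> ?P (x + \<xi> r \<omega>) < c / 2}"
      by (auto simp: D_def)
    thus ?thesis using sets.Int[OF now before] by simp
  qed
  have G[measurable]: "?G \<in> sets M" by measurable
  have first_passage: "c / 2 * prob (D s) \<le> prob (D s \<inter> ?G)" if s: "s \<in> F" for s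
  proof -
    note [measurable] = D[OF s] xi[OF s]
    define J where "J = {r\<in>F. r \<le> s}"
    have J: "finite J" "J \<subseteq> {0..s}" "s \<in> J" using F s nn by (auto simp: J_def)
    have proj[measurable]: "(\<lambda>v. v r) \<in> borel_measurable (PiM J (\<lambda>_. borel))" if "r \<in> J" for r
      using that by (rule measurable_component_singleton)
    note [measurable] = proj[OF J(3)]
    (* D s as a set of finite pasts, the form that the Markov property requires. *)
    define D' where "D' = {v\<in>space (PiM J (\<lambda>_. borel)). ?P (x + v s) < c / 2} \<inter>
        {v\<in>space (PiM J (\<lambda>_. borel)). \<forall>r\<in>{r\<in>F. r < s}. \<not> ?P (x + v r) < c / 2}"
    have D'[measurable]: "D' \<in> sets (PiM J (\<lambda>_. borel))"
      unfolding D'_def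
    proof (rule sets.Int)
      show "{v\<in>space (PiM J (\<lambda>_. borel)). \<forall>r\<in>{r\<in>F. r < s}. \<not> ?P (x + v r) < c / 2} \<in> sets (PiM J (\<lambda>_. borel))"
      proof (rule sets.sets_Collect_finite_All)
        fix r assume "r \<in> {r\<in>F. r < s}"
        hence [measurable]: "(\<lambda>v. v r) \<in> borel_measurable (PiM J (\<lambda>_. borel))" by (intro proj) (auto simp: J_def)
        show "{v\<in>space (PiM J (\<lambda>_. borel)). \<not> ?P (x + v r) < c / 2} \<in> sets (PiM J (\<lambda>_. borel))"
          by measurable
      qed (use F(1) in auto)
    qed measurable
    have ind: "indicator D' (\<lambda>j\<in>J. \<xi> j \<omega>) = (indicator (D s) \<omega> :: ennreal)" if "\<omega> \<in> space M" for \<omega>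
      using that s by (auto simp: D'_def D_def indicator_def space_PiM J_def)
    have markov: "emeasure M {\<omega>\<in>D s. ?tail s \<omega> \<in> B}
        = (\<integral>\<^sup>+\<omega>. indicator (D s) \<omega> * ennreal (perpetual_prob f B (x + \<xi> s \<omega>)) \<partial>M)"
      if B[measurable]: "B \<in> sets borel" for B
    proof -
      have "{\<omega>\<in>D s. ?tail s \<omega> \<in> B} = D s \<inter> {\<omega>\<in>space M. ?tail s \<omega> \<in> B}"
        by (auto simp: D_def)
      hence "emeasure M {\<omega>\<in>D s. ?tail s \<omega> \<in> B} = (\<integral>\<^sup>+\<omega>. indicator (D s \<inter> {\<omega>\<in>space M. ?tail s \<omega> \<in> B}) \<omega> \<partial>M)"
        by (subst nn_integral_indicator) auto
      also have "\<dots> = (\<integral>\<^sup>+\<omega>. indicator D' (\<lambda>j\<in>J. \<xi> j \<omega>) * indicator B (?tail s \<omega>) \<partial>M)"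
        by (intro nn_integral_cong, subst ind) (auto simp: indicator_def)
      also have "\<dots> = (\<integral>\<^sup>+\<omega>. indicator D' (\<lambda>j\<in>J. \<xi> j \<omega>) * ennreal (perpetual_prob f B (x + \<xi> s \<omega>)) \<partial>M)"
        by (rule markov_perpetual_prob[OF nn[OF s] J]) measurable
      also have "\<dots> = (\<integral>\<^sup>+\<omega>. indicator (D s) \<omega> * ennreal (perpetual_prob f B (x + \<xi> s \<omega>)) \<partial>M)"
        by (intro nn_integral_cong) (simp add: ind)
      finally show ?thesis .
    qed
    have le1: "prob {\<omega>\<in>D s. ?tail s \<omega> \<in> {..1}} \<le> c / 2 * prob (D s)"
    proof -
      have "emeasure M {\<omega>\<in>D s. ?tail s \<omega> \<in> {..1}}
          = (\<integral>\<^sup>+\<omega>. indicator (D s) \<omega> * ennreal (?P (x + \<xi> s \<omega>)) \<partial>M)"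
        by (rule markov) simp
      also have "\<dots> \<le> (\<integral>\<^sup>+\<omega>. ennreal (c / 2) * indicator (D s) \<omega> \<partial>M)"
        by (intro nn_integral_mono) (auto simp: indicator_def D_def intro!: ennreal_leI)
      also have "\<dots> = ennreal (c / 2 * prob (D s))"
        using c by (subst ennreal_mult') (auto simp: nn_integral_cmult emeasure_eq_measure)
      finally show ?thesis using c by (simp add: emeasure_eq_measure)
    qed
    have eq: "prob {\<omega>\<in>D s. ?tail s \<omega> \<in> {..<\<infinity>}} = c * prob (D s)"
    proof -
      have "emeasure M {\<omega>\<in>D s. ?tail s \<omega> \<in> {..<\<infinity>}}
          = (\<integral>\<^sup>+\<omega>. indicator (D s) \<omega> * ennreal (perpetual_prob f {..<\<infinity>} (x + \<xi> s \<omega>)) \<partial>M)"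
        by (rule markov) simp
      also have "\<dots> = (\<integral>\<^sup>+\<omega>. ennreal c * indicator (D s) \<omega> \<partial>M)"
        by (intro nn_integral_cong_AE,
            use AE_perpetual_prob_finite_const[OF f nn[OF s], of x] in eventually_elim)
           (auto simp: c_def mult.commute)
      also have "\<dots> = ennreal (c * prob (D s))"
        using c by (subst ennreal_mult') (auto simp: nn_integral_cmult emeasure_eq_measure)
      finally show ?thesis using c by (simp add: emeasure_eq_measure)
    qed
    have m1: "{\<omega>\<in>D s. ?tail s \<omega> \<in> B} \<in> sets M" if [measurable]: "B \<in> sets borel" for B
    proof -
      have "{\<omega>\<in>D s. ?tail s \<omega> \<in> B} = D s \<inter> {\<omega>\<in>space M. ?tail s \<omega> \<in> B}" by (auto simp: D_def)
      thus ?thesis by simp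
    qed
    have "c * prob (D s) - c / 2 * prob (D s)
        \<le> prob {\<omega>\<in>D s. ?tail s \<omega> \<in> {..<\<infinity>}} - prob {\<omega>\<in>D s. ?tail s \<omega> \<in> {..1}}"
      using le1 eq by simp
    also have "\<dots> = prob ({\<omega>\<in>D s. ?tail s \<omega> \<in> {..<\<infinity>}} - {\<omega>\<in>D s. ?tail s \<omega> \<in> {..1}})"
    proof (rule finite_measure_Diff[symmetric])
      show "{\<omega>\<in>D s. ?tail s \<omega> \<in> {..1}} \<subseteq> {\<omega>\<in>D s. ?tail s \<omega> \<in> {..<\<infinity>}}"
        using ennreal_one_less_top by (auto intro: order.strict_trans1)
    qed (intro m1; simp)+
    also have "\<dots> \<le> prob (D s \<inter> ?G)"
    proof (rule finite_measure_mono_AE)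
      show "AE \<omega> in M. \<omega> \<in> {\<omega>\<in>D s. ?tail s \<omega> \<in> {..<\<infinity>}} - {\<omega>\<in>D s. ?tail s \<omega> \<in> {..1}} \<longrightarrow> \<omega> \<in> D s \<inter> ?G"
        using AE_tail_integral_finite_iff[OF f, of x]
      proof eventually_elim
        case (elim \<omega>)
        have "?tail s \<omega> \<le> ?tail T \<omega>" using F s by (intro tail_integral_antimono) auto
        moreover have "?tail s \<omega> < \<infinity> \<longleftrightarrow> ?tail 0 \<omega> < \<infinity>" using elim nn[OF s] by blast
        ultimately show ?case by (auto simp: D_def not_le intro: order.strict_trans2)
      qed
    qed measurable
    finally show ?thesis by simp
  qed
  have "?bad \<subseteq> (\<Union>s\<in>F. D s)"
  proof
    fix \<omega> assume \<omega>: "\<omega> \<in> ?bad"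
    let ?S = "{s\<in>F. ?P (x + \<xi> s \<omega>) < c / 2}"
    have S: "finite ?S" "?S \<noteq> {}" using F(1) \<omega> by auto
    obtain m where m: "m \<in> ?S" "\<And>r. r \<in> ?S \<Longrightarrow> m \<le> r"
      using that[of "Min ?S"] Min_in[OF S] Min_le[OF S(1)] by blast
    have "\<omega> \<in> D m"
      unfolding D_def
    proof (intro CollectI conjI ballI notI)
      fix r assume "r \<in> {r\<in>F. r < m}" "?P (x + \<xi> r \<omega>) < c / 2"
      thus False using m(2)[of r] by simp
    qed (use m(1) \<omega> in auto)
    moreover have "m \<in> F" using m(1) by simp
    ultimately show "\<omega> \<in> (\<Union>s\<in>F. D s)" by blast
  qed
  moreover have disj: "disjoint_family_on D F"
    unfolding disjoint_family_on_def D_def by (auto, metis linorder_neqE)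
  ultimately have "prob ?bad \<le> (\<Sum>s\<in>F. prob (D s))"
    using F(1) D by (subst finite_measure_finite_Union[symmetric]) (auto intro!: finite_measure_mono)
  hence "c / 2 * prob ?bad \<le> c / 2 * (\<Sum>s\<in>F. prob (D s))"
    using c by (intro mult_left_mono) auto
  also have "\<dots> \<le> (\<Sum>s\<in>F. prob (D s \<inter> ?G))"
    unfolding sum_distrib_left by (intro sum_mono first_passage)
  also have "\<dots> = prob (\<Union>s\<in>F. D s \<inter> ?G)"
    using F(1) D G disj by (intro finite_measure_finite_Union[symmetric]) (auto simp: disjoint_family_on_def)
  also have "\<dots> \<le> prob ?G"
    by (intro finite_measure_mono G) auto
  finally show ?thesis .
qed

text \<open>
  The bound in the maximal inequality is uniform in the finite set of times, so it extends to all
  rational times after \<open>n\<close>. It tends to 0 because the tails of a finite integral do.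
\<close>

lemma AE_eventually_perpetual_prob_ge_rational:
  fixes x :: real
  assumes f[measurable]: "f \<in> borel_measurable borel" "locally_bounded f"
  defines "c \<equiv> perpetual_prob f {..<\<infinity>} x"
  assumes c: "0 < c"
  shows "AE \<omega> in M. \<exists>n::nat. \<forall>q\<in>\<rat>. real n \<le> q \<longrightarrow> c / 2 \<le> perpetual_prob f {..1} (x + \<xi> q \<omega>)"
proof -
  let ?P = "perpetual_prob f {..1}"
  define G where "G n = {\<omega>\<in>space M. 1 < tail_integral f (real n) x (shifted_path 0 \<omega>)
                        \<and> tail_integral f 0 x (shifted_path 0 \<omega>) < \<infinity>}" for n :: nat
  define R where "R n = \<rat> \<inter> {real n..}" for n :: nat
  define Bad where "Bad n = (\<Union>q\<in>R n. {\<omega>\<in>space M. ?P (x + \<xi> q \<omega>) < c / 2})" for n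
  have G[measurable]: "G n \<in> sets M" for n unfolding G_def by measurable
  have R: "countable (R n)" "R n \<noteq> {}" for n
  proof -
    show "countable (R n)" unfolding R_def by (intro countable_Int1 countable_rat)
    show "R n \<noteq> {}" unfolding R_def using Rats_of_nat[of n] by (force simp del: Rats_of_nat)
  qed
  have set_q: "{\<omega>\<in>space M. ?P (x + \<xi> q \<omega>) < c / 2} \<in> sets M" if "q \<in> R n" for q n
  proof -
    have [measurable]: "\<xi> q \<in> borel_measurable M" using that by (auto simp: R_def intro: random_variable_levy)
    show ?thesis by measurable
  qed
  have Bad[measurable]: "Bad n \<in> sets M" for n
    unfolding Bad_def using R set_q by (intro sets.countable_UN') auto
  have bound: "c / 2 * prob (Bad n) \<le> prob (G n)" for n
  proof -
    define F where "F k = from_nat_into (R n) ` {..k}" for k :: nat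
    define B where "B k = (\<Union>q\<in>F k. {\<omega>\<in>space M. ?P (x + \<xi> q \<omega>) < c / 2})" for k
    have F: "finite (F k)" "F k \<subseteq> R n" for k
      unfolding F_def using from_nat_into[OF R(2)] by auto
    have "B k \<in> sets M" for k
      unfolding B_def using F(2)[of k] by (intro sets.finite_UN F(1) set_q[of _ n]) blast
    moreover have "incseq B"
      unfolding incseq_def B_def F_def by (intro allI impI UN_mono image_mono) auto
    moreover have "(\<Union>k. B k) = Bad n"
    proof -
      have "(\<Union>k. F k) = R n"
        unfolding F_def using range_from_nat_into[OF R(2,1)] by (auto simp: image_iff) blast+
      thus ?thesis unfolding B_def Bad_def by blast
    qed
    ultimately have "(\<lambda>k. prob (B k)) \<longlonglongrightarrow> prob (Bad n)"
      using finite_Lim_measure_incseq[of B] by auto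
    hence "(\<lambda>k. c / 2 * prob (B k)) \<longlonglongrightarrow> c / 2 * prob (Bad n)" by (intro tendsto_intros)
    moreover have "c / 2 * prob (B k) \<le> prob (G n)" for k
    proof -
      have "B k = {\<omega>\<in>space M. \<exists>s\<in>F k. ?P (x + \<xi> s \<omega>) < c / 2}" by (auto simp: B_def)
      thus ?thesis
        using perpetual_prob_maximal_inequality[OF f, of "real n" "F k" x] F[of k]
        unfolding G_def c_def R_def by auto
    qed
    ultimately show ?thesis by (intro LIMSEQ_le_const2[where a = "prob (G n)"]) auto
  qed
  have "(\<lambda>n. prob (G n)) \<longlonglongrightarrow> 0"
  proof -
    have "decseq G"
      unfolding decseq_def G_def
    proof (intro allI impI Collect_mono, elim conjE, intro conjI)
      fix m n :: nat and \<omega>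
      assume "m \<le> n" and "1 < tail_integral f (real n) x (shifted_path 0 \<omega>)"
      thus "1 < tail_integral f (real m) x (shifted_path 0 \<omega>)"
        using tail_integral_antimono[of "real m" "real n" f x "shifted_path 0 \<omega>"] by auto
    qed
    hence "(\<lambda>n. prob (G n)) \<longlonglongrightarrow> prob (\<Inter>n. G n)"
      by (intro finite_Lim_measure_decseq) auto
    moreover have "(\<Inter>n. G n) = {}"
    proof (rule equals0I)
      fix \<omega> assume "\<omega> \<in> (\<Inter>n. G n)"
      hence big: "1 < tail_integral f (real n) x (shifted_path 0 \<omega>)"
        and fin: "tail_integral f 0 x (shifted_path 0 \<omega>) < \<infinity>" for n by (auto simp: G_def)
      have "(\<lambda>n. tail_integral f (real n) x (shifted_path 0 \<omega>)) \<longlonglongrightarrow> 0"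
        by (rule tail_integral_tendsto_zero[OF f(1) _ fin]) simp
      hence "eventually (\<lambda>n. tail_integral f (real n) x (shifted_path 0 \<omega>) < 1) sequentially"
        by (rule order_tendstoD) simp
      then obtain n where "tail_integral f (real n) x (shifted_path 0 \<omega>) < 1"
        by (auto simp: eventually_sequentially)
      with big[of n] show False by simp
    qed
    ultimately show ?thesis by simp
  qed
  moreover have "c / 2 * prob (\<Inter>n. Bad n) \<le> prob (G n)" for n
  proof -
    have "prob (\<Inter>n. Bad n) \<le> prob (Bad n)" by (intro finite_measure_mono) auto
    hence "c / 2 * prob (\<Inter>n. Bad n) \<le> c / 2 * prob (Bad n)" using c by simp
    with bound[of n] show ?thesis by linarith
  qed
  ultimately have "c / 2 * prob (\<Inter>n. Bad n) \<le> 0" by (intro LIMSEQ_le_const) auto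
  hence "prob (\<Inter>n. Bad n) = 0"
    using c by (simp add: mult_le_0_iff measure_le_0_iff)
  hence "AE \<omega> in M. \<omega> \<notin> (\<Inter>n. Bad n)"
    by (intro AE_not_in null_setsI) (auto simp: emeasure_eq_measure)
  with AE_space show ?thesis
  proof eventually_elim
    case (elim \<omega>)
    then obtain n where "\<omega> \<notin> Bad n" by blast
    thus ?case using elim(1) by (intro exI[of _ n]) (auto simp: Bad_def R_def not_less)
  qed
qed

text \<open>
  By Fatou's lemma the perpetual integral is lower semicontinuous in the starting point, hence
  \<open>h\<close> is upper semicontinuous.
\<close>

lemma closed_perpetual_prob_ge:
  assumes cont: "continuous_on UNIV f"
  shows "closed {y. \<delta> \<le> perpetual_prob f {..1} y}"
  unfolding closed_sequential_limits
proof (intro allI impI, elim conjE)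
  fix Y y assume Y: "\<forall>n. Y n \<in> {y. \<delta> \<le> perpetual_prob f {..1} y}" and lim: "Y \<longlonglongrightarrow> y"
  have [measurable]: "f \<in> borel_measurable borel" using cont by (rule borel_measurable_continuous_onI)
  define A where "A n = {\<omega>\<in>space M. tail_integral f 0 (Y n) (shifted_path 0 \<omega>) \<in> {..1}}" for n
  define B where "B n = (\<Union>m\<in>{n..}. A m)" for n
  have [measurable]: "A n \<in> sets M" for n unfolding A_def by measurable
  have [measurable]: "B n \<in> sets M" for n unfolding B_def by measurable
  have "decseq B" unfolding decseq_def B_def by (intro allI impI UN_mono) auto
  hence "(\<lambda>n. prob (B n)) \<longlonglongrightarrow> prob (\<Inter>n. B n)"
    by (intro finite_Lim_measure_decseq) auto
  moreover have "\<delta> \<le> prob (B n)" for n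
  proof -
    have "\<delta> \<le> prob (A n)" using Y by (simp add: perpetual_prob_def A_def)
    also have "\<dots> \<le> prob (B n)" by (rule finite_measure_mono) (auto simp: B_def)
    finally show ?thesis .
  qed
  ultimately have "\<delta> \<le> prob (\<Inter>n. B n)" by (intro LIMSEQ_le_const) auto
  also have "\<dots> \<le> perpetual_prob f {..1} y"
    unfolding perpetual_prob_def
  proof (rule finite_measure_mono)
    show "(\<Inter>n. B n) \<subseteq> {\<omega>\<in>space M. tail_integral f 0 y (shifted_path 0 \<omega>) \<in> {..1}}"
    proof
      fix \<omega> assume "\<omega> \<in> (\<Inter>n. B n)"
      hence \<omega>: "\<omega> \<in> space M" and freq: "\<exists>m\<ge>n. tail_integral f 0 (Y m) (shifted_path 0 \<omega>) \<le> 1" for n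
        by (auto simp: B_def A_def)
      let ?p = "right_limit (shifted_path 0 \<omega>)"
      have "tail_integral f 0 y (shifted_path 0 \<omega>)
          = (\<integral>\<^sup>+s. liminf (\<lambda>n. ennreal (f (Y n + ?p s)) * indicator {0..} s) \<partial>lborel)"
        unfolding tail_integral_def
      proof (intro nn_integral_cong)
        fix s
        have "(\<lambda>n. f (Y n + ?p s)) \<longlonglongrightarrow> f (y + ?p s)"
          using cont lim
          by (intro continuous_on_tendsto_compose[OF cont] tendsto_intros) auto
        hence "(\<lambda>n. ennreal (f (Y n + ?p s)) * indicator {0..} s)
            \<longlonglongrightarrow> ennreal (f (y + ?p s)) * indicator {0..} s"
          by (auto simp: indicator_def intro!: tendsto_ennrealI)
        thus "ennreal (f (y + ?p s)) * indicator {0..} s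
            = liminf (\<lambda>n. ennreal (f (Y n + ?p s)) * indicator {0..} s)"
          by (intro lim_imp_Liminf[symmetric]) auto
      qed
      also have "\<dots> \<le> liminf (\<lambda>n. tail_integral f 0 (Y n) (shifted_path 0 \<omega>))"
        unfolding tail_integral_def by (intro nn_integral_liminf) measurable
      also have "\<dots> \<le> 1"
        unfolding liminf_SUP_INF
      proof (rule SUP_least)
        fix n
        obtain m where "m \<ge> n" "tail_integral f 0 (Y m) (shifted_path 0 \<omega>) \<le> 1" using freq by blast
        thus "(INF m\<in>{n..}. tail_integral f 0 (Y m) (shifted_path 0 \<omega>)) \<le> 1"
          by (intro INF_lower2[of m]) auto
      qed
      finally show "\<omega> \<in> {\<omega>\<in>space M. tail_integral f 0 y (shifted_path 0 \<omega>) \<in> {..1}}"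
        using \<omega> by simp
    qed
  qed measurable
  finally show "y \<in> {y. \<delta> \<le> perpetual_prob f {..1} y}" by simp
qed

lemma transient_complement_exists_continuous:
  assumes cont: "continuous_on UNIV f"
    and not_inf: "\<not> (AE \<omega> in M. \<not> perpetual_integral \<xi> f x \<omega> < \<infinity>)"
  shows "\<exists>E\<in>sets borel. transient_set M \<xi> x (- E) \<and> potential_integral M \<xi> f x E < \<infinity>"
proof -
  have f[measurable]: "f \<in> borel_measurable borel" and lb: "locally_bounded f"
    using cont by (auto intro: borel_measurable_continuous_onI continuous_imp_locally_bounded)
  define c where "c = perpetual_prob f {..<\<infinity>} x"
  let ?P = "perpetual_prob f {..1}" and ?E = "{y. c / 2 \<le> perpetual_prob f {..1} y}"
  have c: "0 < c"
  proof (rule ccontr)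
    assume "\<not> 0 < c"
    hence "c = 0" using perpetual_prob_bounds(1)[of f "{..<\<infinity>}" x] by (simp add: c_def)
    hence "AE \<omega> in M. \<omega> \<notin> {\<omega>\<in>space M. tail_integral f 0 x (shifted_path 0 \<omega>) \<in> {..<\<infinity>}}"
      unfolding c_def perpetual_prob_def
      by (intro AE_not_in null_setsI) (auto simp: emeasure_eq_measure)
    with AE_perpetual_integral_eq[of f x] AE_space
    have "AE \<omega> in M. \<not> perpetual_integral \<xi> f x \<omega> < \<infinity>"
      by eventually_elim auto
    with not_inf show False ..
  qed
  have closed: "closed ?E" by (rule closed_perpetual_prob_ge[OF cont])
  have "transient_set M \<xi> x (- ?E)"
    unfolding transient_set_def
    using AE_eventually_perpetual_prob_ge_rational[OF f lb c[unfolded c_def], folded c_def] cadlag_paths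
  proof eventually_elim
    case (elim \<omega>)
    from elim(1) c obtain n :: nat
      where n: "\<And>q. q \<in> \<rat> \<Longrightarrow> real n \<le> q \<Longrightarrow> x + \<xi> q \<omega> \<in> ?E" by auto
    have "x + \<xi> s \<omega> \<in> ?E" if s: "real n \<le> s" for s
    proof -
      have "\<exists>q\<in>\<rat>. s < q \<and> q < s + 1 / real (Suc k)" for k by (rule Rats_dense_in_real) simp
      then obtain q where q: "\<And>k. q k \<in> \<rat>" "\<And>k. s < q k" "\<And>k. q k < s + 1 / real (Suc k)" by metis
      have "q \<longlonglongrightarrow> s"
      proof (rule tendsto_sandwich[of "\<lambda>_. s" _ _ "\<lambda>k. s + 1 / real (Suc k)"])
        show "(\<lambda>k. s + 1 / real (Suc k)) \<longlonglongrightarrow> s"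
          using tendsto_add[OF tendsto_const LIMSEQ_inverse_real_of_nat, of s]
          by (simp add: inverse_eq_divide)
      qed (use q(2,3) in \<open>auto intro: less_imp_le always_eventually simp del: of_nat_Suc\<close>)
      hence "filterlim q (at_right s) sequentially"
        unfolding filterlim_at
        using q(2) by (auto intro!: always_eventually simp: less_imp_neq[THEN not_sym])
      moreover have "((\<lambda>r. \<xi> r \<omega>) \<longlongrightarrow> \<xi> s \<omega>) (at_right s)"
        using elim(2) s by (auto simp: continuous_within)
      ultimately have "(\<lambda>k. \<xi> (q k) \<omega>) \<longlonglongrightarrow> \<xi> s \<omega>" by (rule filterlim_compose[rotated])
      hence "(\<lambda>k. x + \<xi> (q k) \<omega>) \<longlonglongrightarrow> x + \<xi> s \<omega>" by (intro tendsto_intros)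
      moreover have "x + \<xi> (q k) \<omega> \<in> ?E" for k
        using q(1,2)[of k] s by (intro n) auto
      ultimately show ?thesis by (rule closed_sequentially[OF closed, rotated])
    qed
    thus ?case by (intro exI[of _ "real n"]) auto
  qed
  moreover have "potential_integral M \<xi> f x ?E < \<infinity>"
    using c by (intro potential_integral_perpetual_prob_ge[OF f, of "c / 2"]) auto
  ultimately show ?thesis using closed by (intro bexI[of _ ?E]) auto
qed

end

section \<open>Characterisation of finite perpetual integrals\<close>

theorem theorem2p1:
  fixes M :: "'a measure" and \<xi> :: "real \<Rightarrow> 'a \<Rightarrow> real" and f :: "real \<Rightarrow> real" and x :: real
  assumes "levy_process M \<xi>"
    and "AE \<omega> in M. filterlim (\<lambda>s. \<xi> s \<omega>) at_top at_top"
    and "\<And>y. 0 \<le> f y"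
    and "f \<in> borel_measurable borel"
    and "continuous_on UNIV f \<or> (locally_bounded f \<and> ultimately_nonincreasing f)"
  shows "((AE \<omega> in M. \<not> perpetual_integral \<xi> f x \<omega> < \<infinity>) \<longleftrightarrow>
           (\<forall>E\<in>sets borel. transient_set M \<xi> x (- E) \<longrightarrow> potential_integral M \<xi> f x E = \<infinity>)) \<and>
         ((\<exists>E\<in>sets borel. transient_set M \<xi> x (- E) \<and> potential_integral M \<xi> f x E < \<infinity>) \<longrightarrow>
           (AE \<omega> in M. perpetual_integral \<xi> f x \<omega> < \<infinity>))"
proof -
  interpret levy_process M \<xi> by fact
  have lb: "locally_bounded f"
    using assms(5) continuous_imp_locally_bounded by blast
  have sufficient: "AE \<omega> in M. perpetual_integral \<xi> f x \<omega> < \<infinity>"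
    if "E \<in> sets borel" "transient_set M \<xi> x (- E)" "potential_integral M \<xi> f x E < \<infinity>" for E
    using AE_perpetual_integral_finite[OF assms(4) lb that] .
  have necessary: "\<exists>E\<in>sets borel. transient_set M \<xi> x (- E) \<and> potential_integral M \<xi> f x E < \<infinity>"
    if not_inf: "\<not> (AE \<omega> in M. \<not> perpetual_integral \<xi> f x \<omega> < \<infinity>)"
    using assms(5)
  proof
    assume "continuous_on UNIV f"
    thus ?thesis using not_inf by (rule transient_complement_exists_continuous)
  next
    assume "locally_bounded f \<and> ultimately_nonincreasing f"
    then obtain l where "antimono_on {l..} f" by (auto simp: ultimately_nonincreasing_def)
    thus ?thesis by (rule transient_complement_exists_nonincreasing[OF assms(4) _ assms(2) not_inf])
  qed
  have exclusive: False
    if "AE \<omega> in M. \<not> perpetual_integral \<xi> f x \<omega> < \<infinity>" "AE \<omega> in M. perpetual_integral \<xi> f x \<omega> < \<infinity>"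
  proof -
    from that have "AE \<omega> in M. False" by eventually_elim simp
    thus False by simp
  qed
  have eq: "potential_integral M \<xi> f x E = \<infinity> \<longleftrightarrow> \<not> potential_integral M \<xi> f x E < \<infinity>" for E
    by (simp add: less_top[symmetric])
  show ?thesis
    unfolding eq using sufficient necessary exclusive by blast
qed

end
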